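(* Let $L$ be a language, and let $\mathbf A$, $\mathbf B$, and $\mathbf D$ be $L$-structures, $\mathbf D$ finite, satisfying $\mathbf D\longrightarrow(\mathbf B)^{\mathbf A}_2$. Then there exists a $\mathbf D$-partite system $\mathbf P$ satisfying $\mathbf P|_L\longrightarrow(\mathbf B)^{\mathbf A}_2$. Moreover, there is a sequence of $\mathbf D$-partite systems $\mathbf P_0,\mathbf P_1,\dots,\mathbf P_m=\mathbf P$ such that: (1) $\mathbf P_0|_L$ is a disjoint union of multiple copies of $\mathbf B$; (2) for every $i<m$ there exists an embedding $\alpha_i\colon\mathbf A\to\mathbf D$ such that $\mathbf P_{i+1}$ is $(\mathbf P_i,\alpha_i(\mathbf A))$-based; (3) for every $i\le m$, if $\mathbf E$ is an irreducible substructure of $\mathbf P_i$ then there is a substructure $\mathbf B'\subseteq\mathbf D$ isomorphic to $\mathbf B$ such that $\pi_{\mathbf P_i}(\mathbf E)$ is a substructure of $\mathbf B'$.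
   Context: Structures have relations and set-valued functions ($F^{\mathbf A}\colon A^n\to\mathcal P(A)$); homomorphisms preserve relations and satisfy $f[F^{\mathbf A}(\vec x)]=F^{\mathbf B}(f(\vec x))$; embeddings are injective homomorphisms with homomorphic inverse. $\mathbf C\longrightarrow(\mathbf B)^{\mathbf A}_2$ means every colouring $\chi\colon\mathrm{Emb}(\mathbf A,\mathbf C)\to\{0,1\}$ admits $f\in\mathrm{Emb}(\mathbf B,\mathbf C)$ with $\chi$ constant on $\{f\circ e:e\in\mathrm{Emb}(\mathbf A,\mathbf B)\}$. Free amalgams: amalgam over $\mathbf A$ in which the two images intersect exactly in the image of $\mathbf A$, cover the vertex set, and every tuple of every relation or function (a tuple $(x_0,\dots,x_{n-1})$ with $x_{n-1}\in F(x_0,\dots,x_{n-2})$) lies inside one image. Irreducible: not the free amalgam of two proper substructures. Homomorphism-embedding: homomorphism which is an embedding on every irreducible substructure. Partite systems: let $L_P$ extend $L$ by finitely many unary relation symbols called predicates. An $L_P$-partite system is a finite $L_P$-structure $\mathbf A$ in which each vertex lies in exactly one predicate and, for every predicate $p$ and relation symbol $R\in L$, each tuple in $R^{\mathbf A}$ contains at most one vertex from $p^{\mathbf A}$; $\pi_{\mathbf A}(v)$ denotes the predicate containing $v$ (the projection), and $\mathbf A|_L$ the $L$-reduct. For a finite $L$-structure $\mathbf D$, take $L_P=L\cup\{p_d:d\in D\}$ and identify each $d\in D$ with $p_d$; a $\mathbf D$-partite system is an $L_P$-partite system $\mathbf B$ such that $\pi_{\mathbf B}$ is a homomorphism-embedding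 $\mathbf B|_L\to\mathbf D$. The $N$-th power $\mathbf B^N$ of a $\mathbf D$-partite system $\mathbf B$ is the $\mathbf D$-partite system $\mathbf C$ with $C=\bigcup_{p\in D}C_p$, $C_p$ the set of functions $N\to B_p$ (where $B_p$ is the set of vertices of $\mathbf B$ in predicate $p$), a tuple $(x_0,\dots,x_{n-1})$ in relation $R\in L_P$ of $\mathbf C$ iff $(x_0(i),\dots,x_{n-1}(i))\in R^{\mathbf B}$ for all $i<N$, and $y\in F^{\mathbf C}(x_0,\dots,x_{n-1})$ iff $y(i)\in F^{\mathbf B}(x_0(i),\dots,x_{n-1}(i))$ for all $i<N$. For a substructure $\mathbf A\subseteq\mathbf D$ and a $\mathbf D$-partite system $\mathbf P$, $\mathbf P|_{\mathbf A}$ is the subsystem induced by $\mathbf P$ on the vertices with projection in $A$. A $\mathbf D$-partite system $\mathbf Q$ is $(\mathbf P,\mathbf A)$-based if there is $N>0$ such that $\mathbf Q$ is obtained from $(\mathbf P|_{\mathbf A})^N$ by extending, using free amalgamation, every embedding $\mathbf P|_{\mathbf A}\to(\mathbf P|_{\mathbf A})^N$ to an embedding $\mathbf P\to\mathbf Q$.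
   Formalization: The projection of a D-partite system must satisfy f[F(x)]=F(f(x)) only where F(x) is non-empty (literally, and on all irreducible substructures, nothing changes for unary functions), and function symbols have positive arity; as written the claim fails for a binary F with F(x,y)={x}. *)

theory Defs
  imports "HOL-Library.FuncSet"
begin

record ('r, 'f) lang =
  Rels :: "'r set"
  Funs :: "'f set"
  rar  :: "'r \<Rightarrow> nat"
  far  :: "'f \<Rightarrow> nat"

record ('v, 'r, 'f) struct =
  verts :: "'v set"
  rint  :: "'r \<Rightarrow> 'v list set"
  fint  :: "'f \<Rightarrow> 'v list \<Rightarrow> 'v set"

text \<open>Function symbols have positive arity. (A non-empty nullary function is a set of constants
  that any two substructures share, so structures would have no disjoint unions.)\<close>

definition language :: "('r, 'f) lang \<Rightarrow> bool" where
  "language L \<longleftrightarrow> (\<forall>F\<in>Funs L. 0 < far L F)"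

definition tuples :: "'v set \<Rightarrow> nat \<Rightarrow> 'v list set" where
  "tuples V n = {xs. set xs \<subseteq> V \<and> length xs = n}"

definition L_structure :: "('r, 'f) lang \<Rightarrow> ('v, 'r, 'f) struct \<Rightarrow> bool" where
  "L_structure L A \<longleftrightarrow>
     (\<forall>R\<in>Rels L. rint A R \<subseteq> tuples (verts A) (rar L R)) \<and>
     (\<forall>F\<in>Funs L. \<forall>xs\<in>tuples (verts A) (far L F). fint A F xs \<subseteq> verts A)"

text \<open>A substructure is given by its vertex set, which has to be closed under the functions.\<close>

definition substructure :: "('r, 'f) lang \<Rightarrow> 'v set \<Rightarrow> ('v, 'r, 'f) struct \<Rightarrow> bool" where
  "substructure L X A \<longleftrightarrow>
     X \<subseteq> verts A \<and> (\<forall>F\<in>Funs L. \<forall>xs\<in>tuples X (far L F). fint A F xs \<subseteq> X)"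

definition induced :: "('v, 'r, 'f) struct \<Rightarrow> 'v set \<Rightarrow> ('v, 'r, 'f) struct" where
  "induced A X = \<lparr>verts = X, rint = (\<lambda>R. {xs \<in> rint A R. set xs \<subseteq> X}), fint = fint A\<rparr>"

definition hom :: "('r, 'f) lang \<Rightarrow> ('v, 'r, 'f) struct \<Rightarrow> ('w, 'r, 'f) struct \<Rightarrow> ('v \<Rightarrow> 'w) \<Rightarrow> bool" where
  "hom L A B f \<longleftrightarrow>
     f ` verts A \<subseteq> verts B \<and>
     (\<forall>R\<in>Rels L. \<forall>xs\<in>rint A R. map f xs \<in> rint B R) \<and>
     (\<forall>F\<in>Funs L. \<forall>xs\<in>tuples (verts A) (far L F). f ` fint A F xs = fint B F (map f xs))"

definition embedding ::
  "('r, 'f) lang \<Rightarrow> ('v, 'r, 'f) struct \<Rightarrow> ('w, 'r, 'f) struct \<Rightarrow> ('v \<Rightarrow> 'w) \<Rightarrow> bool" where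
  "embedding L A B f \<longleftrightarrow>
     inj_on f (verts A) \<and> hom L A B f \<and>
     hom L (induced B (f ` verts A)) A (inv_into (verts A) f)"

definition isomorphic :: "('r, 'f) lang \<Rightarrow> ('v, 'r, 'f) struct \<Rightarrow> ('w, 'r, 'f) struct \<Rightarrow> bool" where
  "isomorphic L A B \<longleftrightarrow> (\<exists>f. embedding L A B f \<and> f ` verts A = verts B)"

definition Emb ::
  "('r, 'f) lang \<Rightarrow> ('v, 'r, 'f) struct \<Rightarrow> ('w, 'r, 'f) struct \<Rightarrow> ('v \<Rightarrow> 'w) set" where
  "Emb L A B = {f \<in> extensional (verts A). embedding L A B f}"

text \<open>\<open>arrows L C B A k\<close> is the partition arrow \<open>C \<longrightarrow> (B)\<close> with upper index \<open>A\<close> and lower index \<open>k\<close>.\<close>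

definition arrows ::
  "('r, 'f) lang \<Rightarrow> ('c, 'r, 'f) struct \<Rightarrow> ('b, 'r, 'f) struct \<Rightarrow> ('a, 'r, 'f) struct \<Rightarrow> nat \<Rightarrow> bool" where
  "arrows L C B A k \<longleftrightarrow>
     (\<forall>\<chi> \<in> Emb L A C \<rightarrow> {..<k}. \<exists>f \<in> Emb L B C. \<exists>c.
        \<forall>e \<in> Emb L A B. \<chi> (compose (verts A) f e) = c)"

definition tuples_within :: "('r, 'f) lang \<Rightarrow> ('v, 'r, 'f) struct \<Rightarrow> 'v set set \<Rightarrow> bool" where
  "tuples_within L C \<S> \<longleftrightarrow>
     (\<forall>R\<in>Rels L. \<forall>xs\<in>rint C R. \<exists>S\<in>\<S>. set xs \<subseteq> S) \<and>
     (\<forall>F\<in>Funs L. \<forall>xs\<in>tuples (verts C) (far L F). \<forall>y\<in>fint C F xs. \<exists>S\<in>\<S>. set (xs @ [y]) \<subseteq> S)"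

definition free_amalgam ::
  "('r, 'f) lang \<Rightarrow> ('a, 'r, 'f) struct \<Rightarrow>
   ('b1, 'r, 'f) struct \<Rightarrow> ('a \<Rightarrow> 'b1) \<Rightarrow> ('b2, 'r, 'f) struct \<Rightarrow> ('a \<Rightarrow> 'b2) \<Rightarrow>
   ('c, 'r, 'f) struct \<Rightarrow> ('b1 \<Rightarrow> 'c) \<Rightarrow> ('b2 \<Rightarrow> 'c) \<Rightarrow> bool" where
  "free_amalgam L A B1 \<alpha>1 B2 \<alpha>2 C \<beta>1 \<beta>2 \<longleftrightarrow>
     embedding L A B1 \<alpha>1 \<and> embedding L A B2 \<alpha>2 \<and>
     embedding L B1 C \<beta>1 \<and> embedding L B2 C \<beta>2 \<and>
     (\<forall>x\<in>verts A. \<beta>1 (\<alpha>1 x) = \<beta>2 (\<alpha>2 x)) \<and>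
     \<beta>1 ` verts B1 \<inter> \<beta>2 ` verts B2 = \<beta>1 ` \<alpha>1 ` verts A \<and>
     verts C = \<beta>1 ` verts B1 \<union> \<beta>2 ` verts B2 \<and>
     tuples_within L C {\<beta>1 ` verts B1, \<beta>2 ` verts B2}"

definition irreducible_struct :: "('r, 'f) lang \<Rightarrow> ('v, 'r, 'f) struct \<Rightarrow> bool" where
  "irreducible_struct L A \<longleftrightarrow>
     \<not> (\<exists>X Y. substructure L X A \<and> X \<noteq> verts A \<and> substructure L Y A \<and> Y \<noteq> verts A \<and>
          free_amalgam L (induced A (X \<inter> Y)) (induced A X) id (induced A Y) id A id id)"

definition irreducible_sub :: "('r, 'f) lang \<Rightarrow> 'v set \<Rightarrow> ('v, 'r, 'f) struct \<Rightarrow> bool" where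
  "irreducible_sub L E A \<longleftrightarrow> substructure L E A \<and> irreducible_struct L (induced A E)"

text \<open>In the underlying homomorphism of a homomorphism-embedding an empty value of a function is
  read as \<open>undefined\<close>: the equation for functions is asked where the value is non-empty. A free
  amalgam has empty values on all tuples that are not inside one part, so for functions of arity at
  least two the projection of a disjoint union of structures to the structure they live in
  need not satisfy the equation on tuples meeting several parts. On irreducible substructures
  the equation holds without exception, and for unary functions nothing changes: see
  \<open>hom_embedding_unary\<close> below.\<close>

definition hom_where_defined ::
  "('r, 'f) lang \<Rightarrow> ('v, 'r, 'f) struct \<Rightarrow> ('w, 'r, 'f) struct \<Rightarrow> ('v \<Rightarrow> 'w) \<Rightarrow> bool" where
  "hom_where_defined L A B f \<longleftrightarrow>
     f ` verts A \<subseteq> verts B \<and>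
     (\<forall>R\<in>Rels L. \<forall>xs\<in>rint A R. map f xs \<in> rint B R) \<and>
     (\<forall>F\<in>Funs L. \<forall>xs\<in>tuples (verts A) (far L F). fint A F xs \<noteq> {} \<longrightarrow>
        f ` fint A F xs = fint B F (map f xs))"

definition hom_embedding ::
  "('r, 'f) lang \<Rightarrow> ('v, 'r, 'f) struct \<Rightarrow> ('w, 'r, 'f) struct \<Rightarrow> ('v \<Rightarrow> 'w) \<Rightarrow> bool" where
  "hom_embedding L A B f \<longleftrightarrow>
     hom_where_defined L A B f \<and> (\<forall>E. irreducible_sub L E A \<longrightarrow> embedding L (induced A E) B f)"

lemma hom_imp_hom_where_defined: "hom L A B f \<Longrightarrow> hom_where_defined L A B f"
  by (auto simp: hom_def hom_where_defined_def)

lemma hom_embedding_unary: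
  assumes unary: "\<And>F. F \<in> Funs L \<Longrightarrow> far L F = 1" and A: "L_structure L A"
  shows "hom_embedding L A B f \<longleftrightarrow>
    hom L A B f \<and> (\<forall>E. irreducible_sub L E A \<longrightarrow> embedding L (induced A E) B f)"
proof
  assume he: "hom_embedding L A B f"
  have "f ` fint A F xs = fint B F (map f xs)"
    if F: "F \<in> Funs L" and xs: "xs \<in> tuples (verts A) (far L F)" for F xs
  proof -
    obtain v where v: "xs = [v]" "v \<in> verts A"
      using xs unary[OF F] by (auto simp: tuples_def length_Suc_conv)
    define X where "X = \<Inter>{S. substructure L S A \<and> v \<in> S}"
    have top: "substructure L (verts A) A"
      using A by (auto simp: substructure_def L_structure_def)
    have X: "substructure L X A"
      unfolding substructure_def
    proof (intro conjI ballI)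
      show "X \<subseteq> verts A" using top v by (auto simp: X_def)
      fix G ys assume G: "G \<in> Funs L" and ys: "ys \<in> tuples X (far L G)"
      show "fint A G ys \<subseteq> X"
        unfolding X_def
      proof (rule Inter_greatest)
        fix S assume S: "S \<in> {S. substructure L S A \<and> v \<in> S}"
        then have "ys \<in> tuples S (far L G)" using ys by (auto simp: tuples_def X_def)
        then show "fint A G ys \<subseteq> S" using S G by (auto simp: substructure_def)
      qed
    qed
    have min: "S = X" if S: "substructure L S (induced A X)" "v \<in> S" for S
    proof -
      have "substructure L S A" using S X by (auto simp: substructure_def induced_def)
      then have "X \<subseteq> S" using S by (auto simp: X_def)
      then show ?thesis using S by (auto simp: substructure_def induced_def)
    qed
    have vX: "v \<in> X" by (auto simp: X_def)
    have "irreducible_struct L (induced A X)"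
      unfolding irreducible_struct_def
    proof (rule notI, elim exE conjE)
      fix Y Z
      assume Y: "substructure L Y (induced A X)" "Y \<noteq> verts (induced A X)"
        and Z: "substructure L Z (induced A X)" "Z \<noteq> verts (induced A X)"
        and fa: "free_amalgam L (induced (induced A X) (Y \<inter> Z)) (induced (induced A X) Y) id
          (induced (induced A X) Z) id (induced A X) id id"
      have "v \<in> Y \<or> v \<in> Z" using fa vX by (auto simp: free_amalgam_def induced_def)
      then show False using min Y Z by (auto simp: induced_def)
    qed
    then have "hom L (induced A X) B f"
      using he X by (auto simp: hom_embedding_def irreducible_sub_def embedding_def)
    then show ?thesis using F v vX unary[OF F] by (auto simp: hom_def induced_def tuples_def)
  qed
  then show "hom L A B f \<and> (\<forall>E. irreducible_sub L E A \<longrightarrow> embedding L (induced A E) B f)"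
    using he by (auto simp: hom_embedding_def hom_def hom_where_defined_def)
qed (auto simp: hom_embedding_def hom_imp_hom_where_defined)

definition pred_lang :: "('r, 'f) lang \<Rightarrow> 'p set \<Rightarrow> ('r + 'p, 'f) lang" where
  "pred_lang L Pr = \<lparr>Rels = Inl ` Rels L \<union> Inr ` Pr, Funs = Funs L,
     rar = case_sum (rar L) (\<lambda>_. 1), far = far L\<rparr>"

definition reduct :: "('v, 'r + 'p, 'f) struct \<Rightarrow> ('v, 'r, 'f) struct" where
  "reduct A = \<lparr>verts = verts A, rint = (\<lambda>R. rint A (Inl R)), fint = fint A\<rparr>"

definition part :: "('v, 'r + 'p, 'f) struct \<Rightarrow> 'p \<Rightarrow> 'v set" where
  "part A p = {v \<in> verts A. [v] \<in> rint A (Inr p)}"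

definition partite_system :: "('r, 'f) lang \<Rightarrow> 'p set \<Rightarrow> ('v, 'r + 'p, 'f) struct \<Rightarrow> bool" where
  "partite_system L Pr A \<longleftrightarrow>
     finite Pr \<and> L_structure (pred_lang L Pr) A \<and> finite (verts A) \<and>
     (\<forall>v\<in>verts A. \<exists>!p. p \<in> Pr \<and> v \<in> part A p) \<and>
     (\<forall>p\<in>Pr. \<forall>R\<in>Rels L. \<forall>xs\<in>rint A (Inl R).
        \<forall>x\<in>set xs. \<forall>y\<in>set xs. x \<in> part A p \<longrightarrow> y \<in> part A p \<longrightarrow> x = y)"

definition projection :: "'p set \<Rightarrow> ('v, 'r + 'p, 'f) struct \<Rightarrow> 'v \<Rightarrow> 'p" where
  "projection Pr A v = (THE p. p \<in> Pr \<and> v \<in> part A p)"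

text \<open>The vertex \<open>d\<close> of \<open>D\<close> serves as the name of its own predicate \<open>Inr d\<close>.\<close>

definition D_partite ::
  "('r, 'f) lang \<Rightarrow> ('d, 'r, 'f) struct \<Rightarrow> ('v, 'r + 'd, 'f) struct \<Rightarrow> bool" where
  "D_partite L D B \<longleftrightarrow>
     partite_system L (verts D) B \<and> hom_embedding L (reduct B) D (projection (verts D) B)"

definition power_system ::
  "('d, 'r, 'f) struct \<Rightarrow> ('v, 'r + 'd, 'f) struct \<Rightarrow> nat \<Rightarrow> (nat \<Rightarrow> 'v, 'r + 'd, 'f) struct" where
  "power_system D B N = (let C = (\<Union>p\<in>verts D. {..<N} \<rightarrow>\<^sub>E part B p) in
     \<lparr>verts = C,
      rint = (\<lambda>R. {xs. set xs \<subseteq> C \<and> (\<forall>i<N. map (\<lambda>x. x i) xs \<in> rint B R)}),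
      fint = (\<lambda>F xs. {y \<in> C. \<forall>i<N. y i \<in> fint B F (map (\<lambda>x. x i) xs)})\<rparr>)"

definition restrict_system ::
  "('d, 'r, 'f) struct \<Rightarrow> ('v, 'r + 'd, 'f) struct \<Rightarrow> 'd set \<Rightarrow> ('v, 'r + 'd, 'f) struct" where
  "restrict_system D P S = induced P {v \<in> verts P. projection (verts D) P v \<in> S}"

text \<open>\<open>based L D P S Q\<close>: \<open>Q\<close> is \<open>(P, S)\<close>-based, where \<open>S\<close> is the vertex set of a substructure of \<open>D\<close>.
  For every embedding \<open>e\<close> of \<open>restrict_system D P S\<close> into the power \<open>C\<close>, a new copy \<open>\<phi> e\<close> of \<open>P\<close> is
  attached to the copy \<open>\<iota>\<close> of \<open>C\<close>, freely over the image of \<open>e\<close> and freely with respect to the other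
  copies of \<open>P\<close>.\<close>

definition based ::
  "('r, 'f) lang \<Rightarrow> ('d, 'r, 'f) struct \<Rightarrow> ('v, 'r + 'd, 'f) struct \<Rightarrow> 'd set \<Rightarrow>
   ('w, 'r + 'd, 'f) struct \<Rightarrow> bool" where
  "based L D P S Q \<longleftrightarrow>
     (\<exists>N>0. let LP = pred_lang L (verts D); PS = restrict_system D P S;
                C = power_system D PS N; \<E> = Emb LP PS C in
        \<exists>\<iota> \<phi>.
          embedding LP C Q \<iota> \<and>
          (\<forall>e\<in>\<E>. embedding LP P Q (\<phi> e) \<and>
             (\<forall>v\<in>verts PS. \<phi> e v = \<iota> (e v)) \<and>
             \<phi> e ` verts P \<inter> \<iota> ` verts C = \<iota> ` e ` verts PS) \<and>
          (\<forall>e\<in>\<E>. \<forall>e'\<in>\<E>. e \<noteq> e' \<longrightarrow> \<phi> e ` verts P \<inter> \<phi> e' ` verts P \<subseteq> \<iota> ` verts C) \<and>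
          verts Q = \<iota> ` verts C \<union> (\<Union>e\<in>\<E>. \<phi> e ` verts P) \<and>
          tuples_within LP Q (insert (\<iota> ` verts C) ((\<lambda>e. \<phi> e ` verts P) ` \<E>)))"

definition disjoint_union_of_copies ::
  "('r, 'f) lang \<Rightarrow> ('b, 'r, 'f) struct \<Rightarrow> ('v, 'r, 'f) struct \<Rightarrow> bool" where
  "disjoint_union_of_copies L B C \<longleftrightarrow>
     (\<exists>(n::nat) \<beta>. 0 < n \<and>
        (\<forall>j<n. embedding L B C (\<beta> j)) \<and>
        (\<forall>j<n. \<forall>k<n. j \<noteq> k \<longrightarrow> \<beta> j ` verts B \<inter> \<beta> k ` verts B = {}) \<and>
        verts C = (\<Union>j<n. \<beta> j ` verts B) \<and>
        tuples_within L C ((\<lambda>j. \<beta> j ` verts B) ` {..<n}))"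

end

theory Submission
  imports Defs
begin

text \<open>
  Every embedding \<open>b\<close> of \<open>B\<close> into \<open>D\<close> contributes one copy of \<open>B\<close>, with projection \<open>b\<close>, to the
  disjoint union \<open>P\<^sub>0\<close>. For each embedding \<open>\<alpha>\<close> of \<open>A\<close> into \<open>D\<close> in turn, the next system is the one
  based on the previous system \<open>P\<close> and on \<open>\<alpha>(A)\<close>, with the exponent \<open>N\<close> given by the Hales--Jewett
  theorem for the alphabet of all copies of \<open>A\<close> in \<open>P\<close> that project to \<open>\<alpha>\<close>. A combinatorial line
  in these words is an embedding of the part of \<open>P\<close> over \<open>\<alpha>(A)\<close> into its \<open>N\<close>-th power, so that one of
  the attached copies of \<open>P\<close> has all its copies of \<open>A\<close> over \<open>\<alpha>\<close> in one colour. Going back from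
  the last system to \<open>P\<^sub>0\<close>, the colour of a copy of \<open>A\<close> depends only on its projection, and
  the arrow for \<open>D\<close> selects a monochromatic copy of \<open>B\<close>.

  The invariant that carries the projection properties along is that an irreducible substructure
  of a free amalgam lies in one of the parts, while the coordinates of an irreducible substructure
  of a power generate irreducible substructures of the factor.
\<close>

section \<open>The Hales--Jewett theorem\<close>

text \<open>The delicate point is the behaviour of functions. A free amalgam gives empty values to
  tuples that meet several parts, so a projection has to satisfy the function equation only at
  non-empty values, whereas an embedding must respect all values, the empty ones included. Two facts
  bridge the gap. The projection is injective on every single value set, because arguments with a
  value generate an irreducible substructure; hence a value in the power is determined by one of its
  coordinates. And a variable word has at least one variable, where the line is the identity; this
  coordinate makes the line injective, reflects relations, and keeps the value in the power empty
  when it is empty in the factor.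

  Copies of A are sorted by their projection \<alpha> as a map, not by its image, so automorphisms
  of A cause no ambiguity. The sorting survives every step, since the predicates belong to the
  language and embeddings therefore preserve projections.\<close>

text \<open>In a variable word, \<open>None\<close> stands for the variable.\<close>

definition subst_word :: "'a \<Rightarrow> 'a option list \<Rightarrow> 'a list" where
  "subst_word a w = map (case_option a id) w"

definition variable_words :: "'a set \<Rightarrow> nat \<Rightarrow> 'a option list set" where
  "variable_words A n = {w. length w = n \<and> None \<in> set w \<and> set w \<subseteq> insert None (Some ` A)}"

lemma subst_word_append: "subst_word a (v @ w) = subst_word a v @ subst_word a w"
  by (simp add: subst_word_def)

lemma subst_word_Some: "subst_word a (map Some u) = u"
  by (simp add: subst_word_def o_def)

lemma subst_word_tuples:
  "w \<in> variable_words A n \<Longrightarrow> a \<in> A \<Longrightarrow> subst_word a w \<in> tuples A n"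
  by (fastforce simp: subst_word_def variable_words_def tuples_def split: option.splits)

lemma finite_tuples: "finite A \<Longrightarrow> finite (tuples A n)"
  unfolding tuples_def by (rule finite_lists_length_eq)

lemma variable_words_append_left:
  "v \<in> variable_words A m \<Longrightarrow> u \<in> tuples A n \<Longrightarrow> map Some u @ v \<in> variable_words A (n + m)"
  by (auto simp: variable_words_def tuples_def)

lemma variable_words_append_right:
  "v \<in> variable_words A m \<Longrightarrow> u \<in> tuples A n \<Longrightarrow> v @ map Some u \<in> variable_words A (m + n)"
  by (auto simp: variable_words_def tuples_def)

lemma variable_words_append:
  "v \<in> variable_words A m \<Longrightarrow> w \<in> variable_words A n \<Longrightarrow> v @ w \<in> variable_words A (m + n)"
  by (auto simp: variable_words_def)

lemma variable_words_mono: "A \<subseteq> B \<Longrightarrow> variable_words A n \<subseteq> variable_words B n"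
  by (auto simp: variable_words_def)

lemma tuples_append: "u \<in> tuples A m \<Longrightarrow> v \<in> tuples A n \<Longrightarrow> u @ v \<in> tuples A (m + n)"
  by (auto simp: tuples_def)

section \<open>Combinatorial lines and colour focusing\<close>

definition monochromatic :: "('a list \<Rightarrow> nat) \<Rightarrow> 'a set \<Rightarrow> 'a option list \<Rightarrow> bool" where
  "monochromatic \<chi> A w \<longleftrightarrow> (\<forall>a\<in>A. \<forall>b\<in>A. \<chi> (subst_word a w) = \<chi> (subst_word b w))"

definition hales_jewett_number :: "'a set \<Rightarrow> nat \<Rightarrow> nat \<Rightarrow> bool" where
  "hales_jewett_number A r n \<longleftrightarrow>
     (\<forall>\<chi>. (\<forall>u\<in>tuples A n. \<chi> u < r) \<longrightarrow> (\<exists>w\<in>variable_words A n. monochromatic \<chi> A w))"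

text \<open>The configuration of the colour-focusing argument: \<open>s\<close> lines that all end
  in the point \<open>f\<close> at the letter \<open>z\<close> and are monochromatic over
  \<open>A\<close> in pairwise different colours.\<close>

definition focused ::
  "('a list \<Rightarrow> nat) \<Rightarrow> 'a set \<Rightarrow> 'a \<Rightarrow> nat \<Rightarrow> nat \<Rightarrow> (nat \<Rightarrow> 'a option list) \<Rightarrow> (nat \<Rightarrow> nat) \<Rightarrow> 'a list \<Rightarrow> bool"
where
  "focused \<chi> A z n s W c f \<longleftrightarrow>
     f \<in> tuples (insert z A) n \<and> inj_on c {..<s} \<and>
     (\<forall>i<s. W i \<in> variable_words (insert z A) n \<and> subst_word z (W i) = f \<and>
        (\<forall>a\<in>A. \<chi> (subst_word a (W i)) = c i))"

text \<open>Finitely many colourings with \<open>r\<close> colours form one colouring whose colours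
  are the functions from \<open>U\<close> to \<open>r\<close>, coded by \<open>h\<close>. Hence
  \<open>HJ\<close> is assumed for every number of colours.\<close>

lemma hales_jewett_family:
  assumes HJ: "\<And>r. \<exists>n. hales_jewett_number A r n" and U: "finite U"
  shows "\<exists>n. \<forall>\<chi>. (\<forall>u\<in>U. \<forall>v\<in>tuples A n. \<chi> u v < (r::nat)) \<longrightarrow>
    (\<exists>w\<in>variable_words A n. \<forall>u\<in>U. monochromatic (\<chi> u) A w)"
proof -
  define K where "K = (U \<rightarrow>\<^sub>E {..<r})"
  have "finite K" using U by (simp add: K_def finite_PiE)
  then obtain h where h: "bij_betw h K {0..<card K}" using ex_bij_betw_finite_nat by blast
  obtain n where n: "hales_jewett_number A (card K) n" using HJ by blast
  show ?thesis
  proof (rule exI[of _ n], intro allI impI)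
    fix \<chi> :: "'b \<Rightarrow> 'a list \<Rightarrow> nat"
    assume \<chi>: "\<forall>u\<in>U. \<forall>v\<in>tuples A n. \<chi> u v < r"
    define g where "g v = restrict (\<lambda>u. \<chi> u v) U" for v
    have gK: "g v \<in> K" if "v \<in> tuples A n" for v
      using \<chi> that by (auto simp: g_def K_def)
    then have "h (g v) < card K" if "v \<in> tuples A n" for v
      using h that by (fastforce simp: bij_betw_def)
    then obtain w where w: "w \<in> variable_words A n" "monochromatic (\<lambda>v. h (g v)) A w"
      using n[unfolded hales_jewett_number_def, rule_format, of "\<lambda>v. h (g v)"] by blast
    have "\<chi> u (subst_word a w) = \<chi> u (subst_word b w)" if "u \<in> U" "a \<in> A" "b \<in> A" for u a b
    proof -
      have "h (g (subst_word a w)) = h (g (subst_word b w))"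
        using w that unfolding monochromatic_def by blast
      then have "g (subst_word a w) = g (subst_word b w)"
        using h gK subst_word_tuples[OF w(1)] that by (meson bij_betw_def inj_onD)
      then show ?thesis using that by (metis g_def restrict_apply')
    qed
    then show "\<exists>w\<in>variable_words A n. \<forall>u\<in>U. monochromatic (\<chi> u) A w"
      using w(1) unfolding monochromatic_def by blast
  qed
qed

text \<open>Words are extended by a block in which, for every prefix, the colour no longer depends
  on the letter of \<open>A\<close> put for the variable. The old lines and the constant word at the
  focus, all continued by this block, then form a configuration with one colour more.\<close>

lemma color_focusing:
  assumes HJ: "\<And>r. \<exists>n. hales_jewett_number A r n" and A: "finite A" "A \<noteq> {}"
  shows "\<exists>n. \<forall>\<chi>. (\<forall>u\<in>tuples (insert z A) n. \<chi> u < r) \<longrightarrow>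
    (\<exists>w\<in>variable_words (insert z A) n. monochromatic \<chi> (insert z A) w) \<or>
    (\<exists>W c f. focused \<chi> A z n s W c f)"
proof (induction s)
  case 0
  have "focused \<chi> A z 0 0 W c []" for \<chi> W c by (simp add: focused_def tuples_def)
  then show ?case by blast
next
  case (Suc s)
  let ?Z = "insert z A"
  obtain n where n: "\<And>\<chi>. (\<forall>u\<in>tuples ?Z n. \<chi> u < r) \<Longrightarrow>
    (\<exists>w\<in>variable_words ?Z n. monochromatic \<chi> ?Z w) \<or> (\<exists>W c f. focused \<chi> A z n s W c f)"
    using Suc.IH by blast
  have "finite (tuples ?Z n)" using A by (simp add: finite_tuples)
  \<comment> \<open>Prefixes range over the larger alphabet, but the block is stabilised over
    \<open>A\<close> only; what happens at \<open>z\<close> is controlled by the focus.\<close>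
  from hales_jewett_family[OF HJ this, of r] obtain m where
    m: "\<And>\<chi>. (\<forall>u\<in>tuples ?Z n. \<forall>v\<in>tuples A m. \<chi> u v < r) \<Longrightarrow>
    (\<exists>w\<in>variable_words A m. \<forall>u\<in>tuples ?Z n. monochromatic (\<chi> u) A w)" by blast
  show ?case
  proof (rule exI[of _ "n + m"], intro allI impI)
    fix \<chi> :: "'a list \<Rightarrow> nat" assume \<chi>: "\<forall>u\<in>tuples ?Z (n + m). \<chi> u < r"
    have AZ: "v \<in> tuples A m \<Longrightarrow> v \<in> tuples ?Z m" for v by (auto simp: tuples_def)
    have "\<forall>u\<in>tuples ?Z n. \<forall>v\<in>tuples A m. \<chi> (u @ v) < r"
      using \<chi> tuples_append AZ by blast
    from m[of "\<lambda>u v. \<chi> (u @ v)", OF this] obtain v where v: "v \<in> variable_words A m"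
      and mono: "\<And>u. u \<in> tuples ?Z n \<Longrightarrow> monochromatic (\<lambda>v. \<chi> (u @ v)) A v" by blast
    have vZ: "v \<in> variable_words ?Z m" using v variable_words_mono[of A ?Z m] by blast
    obtain a0 where a0: "a0 \<in> A" using A by blast
    define v0 where "v0 = subst_word a0 v"
    have v0: "v0 \<in> tuples ?Z m" unfolding v0_def using subst_word_tuples[OF v a0] AZ by blast
    \<comment> \<open>The colour of a prefix once the block is filled from \<open>A\<close>; by
      \<open>mono\<close> the choice of \<open>a0\<close> does not matter.\<close>
    define \<chi>' where "\<chi>' u = \<chi> (u @ v0)" for u
    have eq: "\<chi> (u @ subst_word a v) = \<chi>' u" if "u \<in> tuples ?Z n" "a \<in> A" for u a
      using mono[OF that(1)] that a0 unfolding monochromatic_def \<chi>'_def v0_def by blast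
    have line_ext: "\<exists>w\<in>variable_words ?Z (n + m). monochromatic \<chi> ?Z w"
      if "w \<in> variable_words ?Z n" "monochromatic \<chi>' ?Z w" for w
    proof
      show "w @ map Some v0 \<in> variable_words ?Z (n + m)"
        using that v0 by (simp add: variable_words_append_right)
      show "monochromatic \<chi> ?Z (w @ map Some v0)"
        using that(2) unfolding monochromatic_def \<chi>'_def subst_word_append subst_word_Some .
    qed
    have "\<forall>u\<in>tuples ?Z n. \<chi>' u < r" using \<chi> tuples_append[OF _ v0] by (simp add: \<chi>'_def)
    from n[OF this] consider (line) w where "w \<in> variable_words ?Z n" "monochromatic \<chi>' ?Z w"
      | (focus) W c f where "focused \<chi>' A z n s W c f" by blast
    then show "(\<exists>w\<in>variable_words ?Z (n + m). monochromatic \<chi> ?Z w) \<or>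
      (\<exists>W c f. focused \<chi> A z (n + m) (Suc s) W c f)"
    proof cases
      case line
      then show ?thesis using line_ext by blast
    next
      case focus
      have f: "f \<in> tuples ?Z n" and inj: "inj_on c {..<s}"
        and W: "\<And>i. i < s \<Longrightarrow> W i \<in> variable_words ?Z n" "\<And>i. i < s \<Longrightarrow> subst_word z (W i) = f"
          "\<And>i a. i < s \<Longrightarrow> a \<in> A \<Longrightarrow> \<chi>' (subst_word a (W i)) = c i"
        using focus by (auto simp: focused_def)
      \<comment> \<open>If the focus carries a colour that has already occurred, the line of this
        colour is monochromatic at \<open>z\<close> as well; otherwise the focus yields a new
        colour.\<close>
      show ?thesis
      proof (cases "\<chi>' f \<in> c ` {..<s}")
        case True
        then obtain i where i: "i < s" "\<chi>' f = c i" by auto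
        then have "\<chi>' (subst_word a (W i)) = c i" if "a \<in> ?Z" for a
          using W that by (cases "a = z") auto
        then have "monochromatic \<chi>' ?Z (W i)" by (simp add: monochromatic_def)
        then show ?thesis using line_ext W(1)[OF i(1)] by blast
      next
        case False
        \<comment> \<open>In an old line both blocks vary together; in the new one the first block
          stays at \<open>f\<close>. All of them pass through \<open>f @ subst_word z v\<close> at
          \<open>z\<close>.\<close>
        define W' where "W' i = (if i < s then W i @ v else map Some f @ v)" for i
        define c' where "c' i = (if i < s then c i else \<chi>' f)" for i
        have "inj_on c' {..<s}" using inj by (auto simp: inj_on_def c'_def)
        moreover have "c' ` {..<s} = c ` {..<s}" "c' s = \<chi>' f" by (auto simp: c'_def)
        ultimately have "inj_on c' {..<Suc s}" using False by (auto simp: lessThan_Suc)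
        moreover have "f @ subst_word z v \<in> tuples ?Z (n + m)"
          using f vZ by (simp add: tuples_append subst_word_tuples)
        moreover have "W' i \<in> variable_words ?Z (n + m)" for i
          using W(1) f vZ by (auto simp: W'_def variable_words_append variable_words_append_left)
        moreover have "subst_word z (W' i) = f @ subst_word z v" for i
          using W(2) by (auto simp: W'_def subst_word_append subst_word_Some)
        moreover have "\<chi> (subst_word a (W' i)) = c' i" if "a \<in> A" for i a
        proof (cases "i < s")
          case True
          have "subst_word a (W i) \<in> tuples ?Z n"
            using subst_word_tuples[OF W(1)[OF True]] that by blast
          then show ?thesis using True that eq W(3)
            by (simp add: W'_def c'_def subst_word_append)
        qed (use that eq f in \<open>simp add: W'_def c'_def subst_word_append subst_word_Some\<close>)
        ultimately have "focused \<chi> A z (n + m) (Suc s) W' c' (f @ subst_word z v)"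
          by (simp add: focused_def)
        then show ?thesis by blast
      qed
    qed
  qed
qed

text \<open>Induction on the alphabet, for all numbers of colours at once, since focusing applies
  the smaller alphabet with a much larger palette. \<open>Suc r\<close> focused lines would need
  more colours than there are, so the other alternative in \<open>color_focusing\<close>, a
  monochromatic line, must hold.\<close>

lemma hales_jewett: "finite A \<Longrightarrow> \<exists>n. hales_jewett_number A r n"
proof (induction A arbitrary: r rule: finite_induct)
  case empty
  have "[None] \<in> variable_words {} 1" by (simp add: variable_words_def)
  then have "hales_jewett_number {} r 1"
    by (auto simp: hales_jewett_number_def monochromatic_def)
  then show ?case by blast
next
  case (insert z A)
  \<comment> \<open>A one-letter alphabet is separate, since focusing needs a letter of
    \<open>A\<close> to fill its block; any line over one letter is monochromatic.\<close>
  show ?case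
  proof (cases "A = {}")
    case True
    have "[None] \<in> variable_words {z} 1" by (simp add: variable_words_def)
    then have "hales_jewett_number {z} r 1"
      by (auto simp: hales_jewett_number_def monochromatic_def)
    then show ?thesis unfolding True by blast
  next
    case False
    obtain n where n: "\<And>\<chi>. (\<forall>u\<in>tuples (insert z A) n. \<chi> u < r) \<Longrightarrow>
      (\<exists>w\<in>variable_words (insert z A) n. monochromatic \<chi> (insert z A) w) \<or>
      (\<exists>W c f. focused \<chi> A z n (Suc r) W c f)"
      using color_focusing[OF insert.IH insert.hyps(1) False, of z r "Suc r"] by blast
    have "hales_jewett_number (insert z A) r n"
      unfolding hales_jewett_number_def
    proof (intro allI impI)
      fix \<chi> :: "'a list \<Rightarrow> nat" assume \<chi>: "\<forall>u\<in>tuples (insert z A) n. \<chi> u < r"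
      have "\<not> focused \<chi> A z n (Suc r) W c f" for W c f
      proof
        assume foc: "focused \<chi> A z n (Suc r) W c f"
        obtain a where a: "a \<in> A" using False by blast
        have "c i < r" if "i < Suc r" for i
        proof -
          have "subst_word a (W i) \<in> tuples (insert z A) n" "\<chi> (subst_word a (W i)) = c i"
            using foc that a by (auto simp: focused_def intro!: subst_word_tuples)
          then show ?thesis using \<chi> by force
        qed
        then have "c ` {..<Suc r} \<subseteq> {..<r}" by auto
        then have "card {..<Suc r} \<le> card {..<r}"
          using foc card_inj_on_le[of c "{..<Suc r}" "{..<r}"] by (simp add: focused_def)
        then show False by simp
      qed
      then show "\<exists>w\<in>variable_words (insert z A) n. monochromatic \<chi> (insert z A) w"
        using n[OF \<chi>] by blast
    qed
    then show ?thesis by blast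
  qed
qed

text \<open>A variable word contains a variable and so is not empty. This supplies the positive
  exponent that a based system demands.\<close>

lemma hales_jewett_number_pos:
  assumes "hales_jewett_number A r n" "0 < r"
  shows "0 < n"
proof -
  obtain w where "w \<in> variable_words A n"
    using assms(1)[unfolded hales_jewett_number_def, rule_format, of "\<lambda>_. 0"] assms(2) by blast
  then show ?thesis by (auto simp: variable_words_def)
qed

section \<open>Embeddings and irreducible substructures\<close>

lemma induced_simps [simp]:
  "verts (induced A X) = X" "fint (induced A X) = fint A"
  "xs \<in> rint (induced A X) R \<longleftrightarrow> xs \<in> rint A R \<and> set xs \<subseteq> X"
  by (auto simp: induced_def)

lemma reduct_simps [simp]:
  "verts (reduct A) = verts A" "fint (reduct A) = fint A" "rint (reduct A) R = rint A (Inl R)"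
  by (auto simp: reduct_def)

lemma pred_lang_simps [simp]:
  "Funs (pred_lang L Pr) = Funs L" "far (pred_lang L Pr) = far L"
  "Rels (pred_lang L Pr) = Inl ` Rels L \<union> Inr ` Pr"
  "rar (pred_lang L Pr) (Inl R) = rar L R" "rar (pred_lang L Pr) (Inr p) = 1"
  by (auto simp: pred_lang_def)

lemma induced_reduct: "induced (reduct A) X = reduct (induced A X)"
  by (simp add: induced_def reduct_def)

lemma L_structure_rint:
  "L_structure L A \<Longrightarrow> R \<in> Rels L \<Longrightarrow> xs \<in> rint A R \<Longrightarrow> set xs \<subseteq> verts A"
  by (auto simp: L_structure_def tuples_def)

lemma L_structure_fint:
  "L_structure L A \<Longrightarrow> F \<in> Funs L \<Longrightarrow> xs \<in> tuples (verts A) (far L F) \<Longrightarrow> fint A F xs \<subseteq> verts A"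
  by (simp add: L_structure_def)

lemma substructureD:
  "substructure L X A \<Longrightarrow> F \<in> Funs L \<Longrightarrow> xs \<in> tuples X (far L F) \<Longrightarrow> y \<in> fint A F xs \<Longrightarrow> y \<in> X"
  unfolding substructure_def by blast

lemma substructure_subset: "substructure L X A \<Longrightarrow> X \<subseteq> verts A"
  by (simp add: substructure_def)

lemma L_structure_length:
  "L_structure L A \<Longrightarrow> R \<in> Rels L \<Longrightarrow> xs \<in> rint A R \<Longrightarrow> length xs = rar L R"
  by (auto simp: L_structure_def tuples_def)

lemma L_structure_induced:
  assumes "L_structure L A" "substructure L X A"
  shows "L_structure L (induced A X)"
  using assms L_structure_length[OF assms(1)]
  by (auto simp: L_structure_def substructure_def tuples_def)

lemma L_structure_reduct: "L_structure (pred_lang L Pr) A \<Longrightarrow> L_structure L (reduct A)"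
  by (fastforce simp: L_structure_def)

lemma substructure_reduct: "substructure (pred_lang L Pr) X A \<longleftrightarrow> substructure L X (reduct A)"
  by (simp add: substructure_def)

lemma substructure_verts: "L_structure L A \<Longrightarrow> substructure L (verts A) A"
  by (auto simp: L_structure_def substructure_def)

lemma substructure_induced:
  "substructure L X A \<Longrightarrow> substructure L Y (induced A X) \<longleftrightarrow> substructure L Y A \<and> Y \<subseteq> X"
  by (auto simp: substructure_def)

lemma substructure_Int:
  "substructure L X A \<Longrightarrow> substructure L Y A \<Longrightarrow> substructure L (X \<inter> Y) A"
  by (fastforce simp: substructure_def tuples_def)

lemma tuples_map: "f ` X \<subseteq> Y \<Longrightarrow> xs \<in> tuples X n \<Longrightarrow> map f xs \<in> tuples Y n"
  by (auto simp: tuples_def)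

text \<open>For the inverse map, the relation clause amounts to reflection of relations, while the
  function clause follows from that of \<open>f\<close>: all values lie in \<open>verts A\<close>,
  where \<open>inv_into\<close> cancels \<open>f\<close>.\<close>

lemma embedding_iff:
  assumes A: "L_structure L A"
  shows "embedding L A B f \<longleftrightarrow> inj_on f (verts A) \<and> f ` verts A \<subseteq> verts B \<and>
    (\<forall>R\<in>Rels L. \<forall>xs. set xs \<subseteq> verts A \<longrightarrow> (map f xs \<in> rint B R \<longleftrightarrow> xs \<in> rint A R)) \<and>
    (\<forall>F\<in>Funs L. \<forall>xs\<in>tuples (verts A) (far L F). fint B F (map f xs) = f ` fint A F xs)"
    (is "?l \<longleftrightarrow> ?r")
proof
  assume l: ?l
  then have inj: "inj_on f (verts A)" and h: "hom L A B f"
    and h': "hom L (induced B (f ` verts A)) A (inv_into (verts A) f)"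
    by (auto simp: embedding_def)
  have "xs \<in> rint A R"
    if "R \<in> Rels L" "set xs \<subseteq> verts A" "map f xs \<in> rint B R" for R xs
  proof -
    have "map f xs \<in> rint (induced B (f ` verts A)) R" using that by auto
    then have "map (inv_into (verts A) f) (map f xs) \<in> rint A R"
      using h' that(1) unfolding hom_def by blast
    also have "map (inv_into (verts A) f) (map f xs) = xs"
      using inj that(2) by (auto simp: map_idI subset_iff)
    finally show ?thesis .
  qed
  then show ?r using inj h by (auto simp: hom_def)
next
  assume r: ?r
  let ?g = "inv_into (verts A) f"
  have inj: "inj_on f (verts A)" using r by blast
  have lift: "map f (map ?g ys) = ys" "set (map ?g ys) \<subseteq> verts A" if "set ys \<subseteq> f ` verts A" for ys
    using that by (auto simp: f_inv_into_f subset_iff inv_into_into intro!: map_idI)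
  have "hom L A B f"
    using r L_structure_rint[OF A] by (auto simp: hom_def)
  moreover have "hom L (induced B (f ` verts A)) A ?g"
    unfolding hom_def
  proof (intro conjI ballI)
    show "?g ` verts (induced B (f ` verts A)) \<subseteq> verts A" by (auto simp: inv_into_into)
    fix R xs assume "R \<in> Rels L" "xs \<in> rint (induced B (f ` verts A)) R"
    then show "map ?g xs \<in> rint A R"
      using r lift[of xs] by (metis induced_simps(3))
  next
    fix F ys assume F: "F \<in> Funs L" and ys: "ys \<in> tuples (verts (induced B (f ` verts A))) (far L F)"
    let ?xs = "map ?g ys"
    have ys': "set ys \<subseteq> f ` verts A" using ys by (simp add: tuples_def)
    have xs: "?xs \<in> tuples (verts A) (far L F)" using ys lift[OF ys'] by (simp add: tuples_def)
    then have "fint B F (map f ?xs) = f ` fint A F ?xs" using r F by blast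
    then have "fint B F ys = f ` fint A F ?xs" using lift[OF ys'] by simp
    then show "?g ` fint (induced B (f ` verts A)) F ys = fint A F ?xs"
      using inv_into_image_cancel[OF inj L_structure_fint[OF A F xs]] by simp
  qed
  ultimately show ?l using inj by (simp add: embedding_def)
qed

lemma embeddingI:
  assumes "L_structure L A" "inj_on f (verts A)" "f ` verts A \<subseteq> verts B"
    "\<And>R xs. R \<in> Rels L \<Longrightarrow> set xs \<subseteq> verts A \<Longrightarrow> map f xs \<in> rint B R \<longleftrightarrow> xs \<in> rint A R"
    "\<And>F xs. F \<in> Funs L \<Longrightarrow> xs \<in> tuples (verts A) (far L F) \<Longrightarrow> fint B F (map f xs) = f ` fint A F xs"
  shows "embedding L A B f"
  using assms by (simp add: embedding_iff)

lemma embeddingD: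
  assumes "L_structure L A" "embedding L A B f"
  shows "inj_on f (verts A)" "f ` verts A \<subseteq> verts B"
    "\<And>R xs. R \<in> Rels L \<Longrightarrow> set xs \<subseteq> verts A \<Longrightarrow> map f xs \<in> rint B R \<longleftrightarrow> xs \<in> rint A R"
    "\<And>F xs. F \<in> Funs L \<Longrightarrow> xs \<in> tuples (verts A) (far L F) \<Longrightarrow> fint B F (map f xs) = f ` fint A F xs"
  using assms by (simp_all add: embedding_iff)

text \<open>\<open>Emb\<close> consists of extensional functions, but composites arise as plain
  functions. Both readings agree because only tuples and values inside the vertex set
  matter.\<close>

lemma embedding_cong:
  assumes A: "L_structure L A" and "\<And>v. v \<in> verts A \<Longrightarrow> f v = g v"
  shows "embedding L A B f \<longleftrightarrow> embedding L A B g"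
proof -
  have imp: "embedding L A B g" if "embedding L A B f" "\<And>v. v \<in> verts A \<Longrightarrow> f v = g v" for f g
  proof -
    note e = embeddingD[OF A that(1)]
    have m: "map g xs = map f xs" if "set xs \<subseteq> verts A" for xs
      using that \<open>\<And>v. v \<in> verts A \<Longrightarrow> f v = g v\<close> by auto
    show ?thesis
    proof (rule embeddingI[OF A])
      show "inj_on g (verts A)" using e(1) that(2) by (simp cong: inj_on_cong)
      show "g ` verts A \<subseteq> verts B" using e(2) that(2) by (auto simp: image_subset_iff)
      show "map g xs \<in> rint B R \<longleftrightarrow> xs \<in> rint A R" if "R \<in> Rels L" "set xs \<subseteq> verts A" for R xs
        unfolding m[OF that(2)] by (rule e(3)[OF that])
      fix F xs assume F: "F \<in> Funs L" and xs: "xs \<in> tuples (verts A) (far L F)"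
      have "g ` fint A F xs = f ` fint A F xs"
        using L_structure_fint[OF A F xs] that(2) by (intro image_cong) auto
      moreover have "map g xs = map f xs" using m[of xs] xs unfolding tuples_def by blast
      ultimately show "fint B F (map g xs) = g ` fint A F xs"
        using e(4)[OF F xs] by metis
    qed
  qed
  show ?thesis using imp[of f g] imp[of g f] assms(2) by auto
qed

lemma embedding_comp:
  assumes A: "L_structure L A" and B: "L_structure L B"
    and f: "embedding L A B f" and g: "embedding L B C g"
  shows "embedding L A C (\<lambda>v. g (f v))"
proof (rule embeddingI[OF A])
  note f = embeddingD[OF A f] and g = embeddingD[OF B g]
  show "inj_on (\<lambda>v. g (f v)) (verts A)"
    using f(1,2) g(1) by (auto simp: inj_on_def image_subset_iff)
  show "(\<lambda>v. g (f v)) ` verts A \<subseteq> verts C" using f(2) g(2) by blast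
  have m: "map (\<lambda>v. g (f v)) xs = map g (map f xs)" for xs by simp
  show "map (\<lambda>v. g (f v)) xs \<in> rint C R \<longleftrightarrow> xs \<in> rint A R"
    if "R \<in> Rels L" "set xs \<subseteq> verts A" for R xs
    unfolding m using f(2) f(3)[OF that] g(3)[of R "map f xs"] that by auto
  fix F xs assume F: "F \<in> Funs L" and xs: "xs \<in> tuples (verts A) (far L F)"
  show "fint C F (map (\<lambda>v. g (f v)) xs) = (\<lambda>v. g (f v)) ` fint A F xs"
    unfolding m using f(4)[OF F xs] g(4)[OF F tuples_map[OF f(2) xs]] by (simp add: image_image)
qed

lemma embedding_compose:
  assumes "L_structure L A" "L_structure L B" "embedding L A B f" "embedding L B C g"
  shows "embedding L A C (compose (verts A) g f)"
  using embedding_comp[OF assms] assms(1)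
  by (subst embedding_cong[of L A _ "\<lambda>v. g (f v)"]) (auto simp: compose_def)

lemma embedding_substructure:
  assumes "L_structure L A" "embedding L A B f"
  shows "substructure L (f ` verts A) B"
  unfolding substructure_def
proof (intro conjI ballI)
  note f = embeddingD[OF assms]
  show "f ` verts A \<subseteq> verts B" by (rule f(2))
  fix F ys assume F: "F \<in> Funs L" and ys: "ys \<in> tuples (f ` verts A) (far L F)"
  define xs where "xs = map (inv_into (verts A) f) ys"
  have xs: "ys = map f xs" "set xs \<subseteq> verts A"
    using ys by (auto simp: xs_def tuples_def f_inv_into_f subset_iff inv_into_into
        intro!: map_idI[symmetric])
  then have xs': "xs \<in> tuples (verts A) (far L F)" using ys by (simp add: tuples_def)
  then show "fint B F ys \<subseteq> f ` verts A"
    using f(4)[OF F xs'] L_structure_fint[OF assms(1) F xs'] xs by auto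
qed

lemma embedding_inclusion:
  "L_structure L A \<Longrightarrow> substructure L X A \<Longrightarrow> embedding L (induced A X) A (\<lambda>v. v)"
  by (rule embeddingI) (auto simp: L_structure_induced substructure_def)

lemma embedding_into_induced:
  assumes "L_structure L A" "embedding L A B f" "f ` verts A \<subseteq> X"
  shows "embedding L A (induced B X) f"
proof (rule embeddingI[OF assms(1)])
  note f = embeddingD[OF assms(1,2)]
  show "inj_on f (verts A)" by (rule f(1))
  show "f ` verts A \<subseteq> verts (induced B X)" using assms(3) by simp
  show "map f xs \<in> rint (induced B X) R \<longleftrightarrow> xs \<in> rint A R"
    if "R \<in> Rels L" "set xs \<subseteq> verts A" for R xs
    using f(3)[OF that] that(2) assms(3) by auto
  show "fint (induced B X) F (map f xs) = f ` fint A F xs"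
    if "F \<in> Funs L" "xs \<in> tuples (verts A) (far L F)" for F xs
    using f(4)[OF that] by simp
qed

text \<open>Arities and closure are read off from \<open>A\<close> through the inverse map, so the
  target can be a raw record; a transported structure gets its well-formedness this way.\<close>

lemma L_structure_image:
  assumes A: "L_structure L A" and f: "embedding L A B f"
  shows "L_structure L (induced B (f ` verts A))"
  unfolding L_structure_def
proof (intro conjI ballI subsetI)
  let ?g = "inv_into (verts A) f"
  fix R ys assume R: "R \<in> Rels L" and ys: "ys \<in> rint (induced B (f ` verts A)) R"
  then have "set ys \<subseteq> f ` verts A" by simp
  then have "map f (map ?g ys) = ys" "set (map ?g ys) \<subseteq> verts A"
    by (auto simp: f_inv_into_f subset_iff inv_into_into intro!: map_idI)
  then have "map ?g ys \<in> rint A R"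
    using embeddingD(3)[OF A f R, of "map ?g ys"] ys by simp
  then have "length ys = rar L R" using A R by (fastforce simp: L_structure_def tuples_def)
  then show "ys \<in> tuples (verts (induced B (f ` verts A))) (rar L R)"
    using ys by (simp add: tuples_def)
next
  fix F ys y assume "F \<in> Funs L" "ys \<in> tuples (verts (induced B (f ` verts A))) (far L F)"
    "y \<in> fint (induced B (f ` verts A)) F ys"
  then show "y \<in> verts (induced B (f ` verts A))"
    using substructureD[OF embedding_substructure[OF A f]] by simp
qed

lemma embedding_inv:
  assumes A: "L_structure L A" and f: "embedding L A B f"
  shows "embedding L (induced B (f ` verts A)) A (inv_into (verts A) f)"
proof -
  note e = embeddingD[OF A f]
  let ?g = "inv_into (verts A) f"
  have lift: "map f (map ?g ys) = ys" "set (map ?g ys) \<subseteq> verts A" if "set ys \<subseteq> f ` verts A" for ys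
    using that by (auto simp: f_inv_into_f subset_iff inv_into_into intro!: map_idI)
  note I = L_structure_image[OF A f]
  show ?thesis
  proof (rule embeddingI[OF I])
    show "inj_on ?g (verts (induced B (f ` verts A)))" by (simp add: inj_on_inv_into)
    show "?g ` verts (induced B (f ` verts A)) \<subseteq> verts A" by (auto simp: inv_into_into)
    show "map ?g ys \<in> rint A R \<longleftrightarrow> ys \<in> rint (induced B (f ` verts A)) R"
      if "R \<in> Rels L" "set ys \<subseteq> verts (induced B (f ` verts A))" for R ys
      using that lift[of ys] e(3)[of R "map ?g ys"] by simp
    fix F ys assume F: "F \<in> Funs L" and ys: "ys \<in> tuples (verts (induced B (f ` verts A))) (far L F)"
    have ys': "set ys \<subseteq> f ` verts A" using ys by (simp add: tuples_def)
    have xs: "map ?g ys \<in> tuples (verts A) (far L F)"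
      using ys lift[OF ys'] by (simp add: tuples_def)
    show "fint A F (map ?g ys) = ?g ` fint (induced B (f ` verts A)) F ys"
      using e(4)[OF F xs] lift[OF ys'] inv_into_image_cancel[OF e(1) L_structure_fint[OF A F xs]]
      by simp
  qed
qed

lemma embedding_reduct:
  assumes "L_structure (pred_lang L Pr) A" "embedding (pred_lang L Pr) A B f"
  shows "embedding L (reduct A) (reduct B) f"
  by (rule embeddingI[OF L_structure_reduct[OF assms(1)]])
    (use embeddingD[OF assms] in auto)

lemma finite_Emb:
  assumes "finite (verts A)" "finite (verts B)"
  shows "finite (Emb L A B)"
proof (rule finite_subset)
  show "Emb L A B \<subseteq> verts A \<rightarrow>\<^sub>E verts B"
    by (auto simp: Emb_def embedding_def hom_def PiE_def)
  show "finite (verts A \<rightarrow>\<^sub>E verts B)" using assms by (simp add: finite_PiE)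
qed

text \<open>Within one structure all maps of the amalgam are inclusions, which are embeddings.
  Freeness then comes down to two sides that cover \<open>E\<close> and tuples that stay on one
  side.\<close>

lemma irreducible_sub_iff:
  assumes A: "L_structure L A"
  shows "irreducible_sub L E A \<longleftrightarrow> substructure L E A \<and>
    (\<forall>X Y. substructure L X A \<longrightarrow> substructure L Y A \<longrightarrow> X \<union> Y = E \<longrightarrow>
       tuples_within L (induced A E) {X, Y} \<longrightarrow> X = E \<or> Y = E)"
proof (cases "substructure L E A")
  case True
  note E = L_structure_induced[OF A True]
  have "free_amalgam L (induced (induced A E) (X \<inter> Y)) (induced (induced A E) X) id
      (induced (induced A E) Y) id (induced A E) id id \<longleftrightarrow>
      X \<union> Y = E \<and> tuples_within L (induced A E) {X, Y}"
    if X: "substructure L X (induced A E)" and Y: "substructure L Y (induced A E)" for X Y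
  proof -
    have XY: "substructure L (X \<inter> Y) (induced A E)" by (rule substructure_Int[OF X Y])
    have "embedding L (induced (induced A E) (X \<inter> Y)) (induced (induced A E) X) id"
      "embedding L (induced (induced A E) (X \<inter> Y)) (induced (induced A E) Y) id"
      using embedding_into_induced[OF L_structure_induced[OF E XY] embedding_inclusion[OF E XY]]
      by (auto simp: id_def)
    moreover have "embedding L (induced (induced A E) X) (induced A E) id"
      "embedding L (induced (induced A E) Y) (induced A E) id"
      using embedding_inclusion[OF E X] embedding_inclusion[OF E Y] by (auto simp: id_def)
    ultimately show ?thesis by (auto simp: free_amalgam_def)
  qed
  then have "irreducible_struct L (induced A E) \<longleftrightarrow>
    (\<forall>X Y. substructure L X (induced A E) \<longrightarrow> substructure L Y (induced A E) \<longrightarrow> X \<union> Y = E \<longrightarrow>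
       tuples_within L (induced A E) {X, Y} \<longrightarrow> X = E \<or> Y = E)"
    unfolding irreducible_struct_def by (metis induced_simps(1))
  then show ?thesis
    unfolding irreducible_sub_def substructure_induced[OF True] using True by (metis Un_upper1 Un_upper2)
qed (simp add: irreducible_sub_def)

lemma irreducible_subD:
  assumes "L_structure L A" "irreducible_sub L E A"
    "substructure L X A" "substructure L Y A" "X \<union> Y = E" "tuples_within L (induced A E) {X, Y}"
  shows "X = E \<or> Y = E"
  using assms(2-) by (auto simp: irreducible_sub_iff[OF assms(1)])

text \<open>Predicates are unary, so their tuples are single vertices and never run across a
  decomposition.\<close>

lemma irreducible_sub_reduct:
  assumes A: "L_structure (pred_lang L Pr) A"
  shows "irreducible_sub (pred_lang L Pr) E A \<longleftrightarrow> irreducible_sub L E (reduct A)"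
proof -
  have "tuples_within (pred_lang L Pr) (induced A E) {X, Y} \<longleftrightarrow>
    tuples_within L (induced (reduct A) E) {X, Y}" if "X \<union> Y = E" for X Y
  proof -
    have "set xs \<subseteq> X \<or> set xs \<subseteq> Y"
      if p: "p \<in> Pr" and xs: "xs \<in> rint A (Inr p)" "set xs \<subseteq> E" for p xs
    proof -
      have "length xs = 1" using A p xs by (fastforce simp: L_structure_def tuples_def)
      then obtain v where "xs = [v]" by (auto simp: length_Suc_conv)
      then show ?thesis using xs \<open>X \<union> Y = E\<close> by auto
    qed
    then show ?thesis unfolding tuples_within_def induced_reduct by (simp add: ball_Un)
  qed
  then show ?thesis
    unfolding irreducible_sub_iff[OF A] irreducible_sub_iff[OF L_structure_reduct[OF A]]
      substructure_reduct by (metis (no_types, lifting))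
qed

lemma irreducible_sub_induced:
  assumes A: "L_structure L A" and X: "substructure L X A" and E: "E \<subseteq> X"
  shows "irreducible_sub L E (induced A X) \<longleftrightarrow> irreducible_sub L E A"
proof -
  have "induced (induced A X) E = induced A E" using E by (auto simp: induced_def)
  then show ?thesis
    using E by (simp add: irreducible_sub_def substructure_induced[OF X])
qed

lemma tuples_withinD:
  assumes "tuples_within L A \<S>"
  shows "\<And>R xs. R \<in> Rels L \<Longrightarrow> xs \<in> rint A R \<Longrightarrow> \<exists>S\<in>\<S>. set xs \<subseteq> S"
    "\<And>F xs y. F \<in> Funs L \<Longrightarrow> xs \<in> tuples (verts A) (far L F) \<Longrightarrow> y \<in> fint A F xs \<Longrightarrow>
      \<exists>S\<in>\<S>. set xs \<subseteq> S \<and> y \<in> S"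
proof -
  show "\<exists>S\<in>\<S>. set xs \<subseteq> S" if "R \<in> Rels L" "xs \<in> rint A R" for R xs
    using assms that unfolding tuples_within_def by blast
  show "\<exists>S\<in>\<S>. set xs \<subseteq> S \<and> y \<in> S"
    if "F \<in> Funs L" "xs \<in> tuples (verts A) (far L F)" "y \<in> fint A F xs" for F xs y
  proof -
    have "\<exists>S\<in>\<S>. set (xs @ [y]) \<subseteq> S" using assms that unfolding tuples_within_def by blast
    then show ?thesis by auto
  qed
qed

text \<open>A family of substructures whose pairwise intersections lie in a common core: an irreducible
  substructure meeting a member outside the core splits into its part in that member and the rest.\<close>

lemma irreducible_sub_in_part:
  assumes A: "L_structure L A" and E: "irreducible_sub L E A"
    and within: "tuples_within L A \<S>" and cover: "verts A \<subseteq> K \<union> \<Union>\<S>"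
    and sub: "\<And>S. S \<in> \<S> \<Longrightarrow> substructure L S A" and K: "substructure L K A"
    and core: "\<And>S S'. S \<in> \<S> \<Longrightarrow> S' \<in> \<S> \<Longrightarrow> S \<noteq> S' \<Longrightarrow> S \<inter> S' \<subseteq> K"
  shows "E \<subseteq> K \<or> (\<exists>S\<in>\<S>. E \<subseteq> S)"
proof (rule disjCI)
  assume no: "\<not> (\<exists>S\<in>\<S>. E \<subseteq> S)"
  have EA: "substructure L E A" using E by (simp add: irreducible_sub_def)
  show "E \<subseteq> K"
  proof
    fix v assume v: "v \<in> E"
    show "v \<in> K"
    proof (rule ccontr)
      assume vK: "v \<notin> K"
      have "v \<in> verts A" using v EA by (auto simp: substructure_def)
      then obtain S where S: "S \<in> \<S>" "v \<in> S" using cover vK by blast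
      \<comment> \<open>The core is counted with the other members, so that \<open>T\<close> meets
        \<open>S\<close> in core vertices only.\<close>
      define T where "T = K \<union> \<Union>(\<S> - {S})"
      have TS: "T \<inter> S \<subseteq> K" using core S(1) by (auto simp: T_def)
      have subT: "substructure L (E \<inter> T) A"
        unfolding substructure_def
      proof (intro conjI ballI subsetI)
        show "x \<in> verts A" if "x \<in> E \<inter> T" for x using that EA by (auto simp: substructure_def)
        fix F xs y assume F: "F \<in> Funs L" and xs: "xs \<in> tuples (E \<inter> T) (far L F)"
          and y: "y \<in> fint A F xs"
        have xsE: "xs \<in> tuples E (far L F)" using xs by (auto simp: tuples_def)
        then have yE: "y \<in> E" using substructureD[OF EA F] y by blast
        have "xs \<in> tuples (verts A) (far L F)"
          using xsE EA by (auto simp: tuples_def substructure_def)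
        then obtain S' where S': "S' \<in> \<S>" "set xs \<subseteq> S'" "y \<in> S'"
          using tuples_withinD(2)[OF within F] y by blast
        \<comment> \<open>The only danger is a tuple lying in \<open>S\<close>; its arguments then
          belong to the core, whose closedness keeps the value in \<open>T\<close>.\<close>
        have "y \<in> T"
        proof (cases "S' = S")
          case True
          then have "xs \<in> tuples K (far L F)" using xs S' TS by (auto simp: tuples_def)
          then show ?thesis using substructureD[OF K F _ y] by (simp add: T_def)
        qed (use S' in \<open>auto simp: T_def\<close>)
        then show "y \<in> E \<inter> T" using yE by simp
      qed
      have within': "tuples_within L (induced A E) {E \<inter> S, E \<inter> T}"
        unfolding tuples_within_def
      proof (intro conjI ballI)
        fix R xs assume "R \<in> Rels L" "xs \<in> rint (induced A E) R"
        then obtain S' where "S' \<in> \<S>" "set xs \<subseteq> S'" "set xs \<subseteq> E"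
          using tuples_withinD(1)[OF within] by (metis induced_simps(3))
        then show "\<exists>S\<in>{E \<inter> S, E \<inter> T}. set xs \<subseteq> S" by (cases "S' = S") (auto simp: T_def)
      next
        fix F xs y assume F: "F \<in> Funs L" and xs: "xs \<in> tuples (verts (induced A E)) (far L F)"
          and y: "y \<in> fint (induced A E) F xs"
        have "xs \<in> tuples (verts A) (far L F)"
          using xs EA by (auto simp: tuples_def substructure_def)
        then obtain S' where "S' \<in> \<S>" "set xs \<subseteq> S'" "y \<in> S'"
          using tuples_withinD(2)[OF within F, of xs y] y by auto
        moreover have "set xs \<subseteq> E" "y \<in> E"
          using xs y substructureD[OF EA F] by (auto simp: tuples_def)
        ultimately show "\<exists>S\<in>{E \<inter> S, E \<inter> T}. set (xs @ [y]) \<subseteq> S"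
          by (cases "S' = S") (auto simp: T_def)
      qed
      have "(E \<inter> S) \<union> (E \<inter> T) = E" using EA cover by (auto simp: T_def substructure_def)
      from irreducible_subD[OF A E substructure_Int[OF EA sub[OF S(1)]] subT this within']
      have "E \<subseteq> S \<or> E \<subseteq> T" by auto
      then show False using no S v vK TS by auto
    qed
  qed
qed

section \<open>Generated substructures and their irreducibility\<close>

definition closure :: "('r, 'f) lang \<Rightarrow> ('v, 'r, 'f) struct \<Rightarrow> 'v set \<Rightarrow> 'v set" where
  "closure L A X = \<Inter>{S. substructure L S A \<and> X \<subseteq> S}"

lemma closure_minimal: "substructure L S A \<Longrightarrow> X \<subseteq> S \<Longrightarrow> closure L A X \<subseteq> S"
  by (auto simp: closure_def)

lemma subset_closure: "X \<subseteq> closure L A X"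
  by (auto simp: closure_def)

lemma substructure_closure:
  assumes A: "L_structure L A" and X: "X \<subseteq> verts A"
  shows "substructure L (closure L A X) A"
  unfolding substructure_def
proof (intro conjI ballI)
  show "closure L A X \<subseteq> verts A" by (rule closure_minimal[OF substructure_verts[OF A] X])
  fix F xs assume F: "F \<in> Funs L" and xs: "xs \<in> tuples (closure L A X) (far L F)"
  have "fint A F xs \<subseteq> S" if "substructure L S A" "X \<subseteq> S" for S
  proof -
    have "xs \<in> tuples S (far L F)"
      using xs closure_minimal[OF that] by (auto simp: tuples_def)
    then show ?thesis using substructureD[OF that(1) F] by blast
  qed
  then show "fint A F xs \<subseteq> closure L A X" by (auto simp: closure_def)
qed

text \<open>Freeness sees an argument tuple only together with a value. One value thus suffices to
  put all arguments on one side, and their closure follows them.\<close>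

lemma irreducible_closure_of_tuple:
  assumes A: "L_structure L A" and F: "F \<in> Funs L" and xs: "xs \<in> tuples (verts A) (far L F)"
    and ne: "fint A F xs \<noteq> {}"
  shows "irreducible_sub L (closure L A (set xs)) A"
proof -
  let ?E = "closure L A (set xs)"
  have E: "substructure L ?E A"
    using xs by (intro substructure_closure[OF A]) (simp add: tuples_def)
  have xsE: "xs \<in> tuples ?E (far L F)" using xs subset_closure by (fastforce simp: tuples_def)
  obtain y where y: "y \<in> fint A F xs" using ne by blast
  have "X = ?E \<or> Y = ?E"
    if "substructure L X A" "substructure L Y A" "X \<union> Y = ?E"
      "tuples_within L (induced A ?E) {X, Y}" for X Y
  proof -
    have "set xs \<subseteq> X \<or> set xs \<subseteq> Y"
      using tuples_withinD(2)[OF that(4) F, of xs y] xsE y by auto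
    then have "?E \<subseteq> X \<or> ?E \<subseteq> Y" using closure_minimal that(1,2) by metis
    then show ?thesis using that(3) by blast
  qed
  then show ?thesis using E by (auto simp: irreducible_sub_iff[OF A])
qed

text \<open>A decomposition of the closure pulls back along \<open>h\<close> to one of
  \<open>E\<close>; as \<open>E\<close> does not split, its image lies on one side, and so does the
  closure. In \<open>hF\<close> only membership is asked, because the coordinate maps of a power
  send values to values without having to reach all of them.\<close>

lemma irreducible_closure_of_hom_image:
  assumes A: "L_structure L A" and B: "L_structure L B" and E: "irreducible_sub L E A"
    and h: "h ` E \<subseteq> verts B"
    and hR: "\<And>R xs. R \<in> Rels L \<Longrightarrow> xs \<in> rint A R \<Longrightarrow> set xs \<subseteq> E \<Longrightarrow> map h xs \<in> rint B R"
    and hF: "\<And>F xs y. F \<in> Funs L \<Longrightarrow> xs \<in> tuples E (far L F) \<Longrightarrow> y \<in> fint A F xs \<Longrightarrow>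
      h y \<in> fint B F (map h xs)"
  shows "irreducible_sub L (closure L B (h ` E)) B"
proof -
  let ?C = "closure L B (h ` E)"
  have C: "substructure L ?C B" by (rule substructure_closure[OF B h])
  have EA: "substructure L E A" using E by (simp add: irreducible_sub_def)
  have hE: "h v \<in> ?C" if "v \<in> E" for v using that subset_closure by fast
  have "X = ?C \<or> Y = ?C"
    if X: "substructure L X B" and Y: "substructure L Y B" and XY: "X \<union> Y = ?C"
      and within: "tuples_within L (induced B ?C) {X, Y}" for X Y
  proof -
    have sub: "substructure L {v \<in> E. h v \<in> Z} A" if Z: "substructure L Z B" for Z
      unfolding substructure_def
    proof (intro conjI ballI subsetI)
      show "v \<in> verts A" if "v \<in> {v \<in> E. h v \<in> Z}" for v
        using that EA by (auto simp: substructure_def)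
      fix F xs y assume F: "F \<in> Funs L" and xs: "xs \<in> tuples {v \<in> E. h v \<in> Z} (far L F)"
        and y: "y \<in> fint A F xs"
      have xsE: "xs \<in> tuples E (far L F)" and "map h xs \<in> tuples Z (far L F)"
        using xs by (auto simp: tuples_def)
      then show "y \<in> {v \<in> E. h v \<in> Z}"
        using hF[OF F xsE y] substructureD[OF EA F xsE y] substructureD[OF Z F] by blast
    qed
    let ?X = "{v \<in> E. h v \<in> X}" and ?Y = "{v \<in> E. h v \<in> Y}"
    have "tuples_within L (induced A E) {?X, ?Y}"
      unfolding tuples_within_def
    proof (intro conjI ballI)
      fix R xs assume R: "R \<in> Rels L" and xs: "xs \<in> rint (induced A E) R"
      then have "map h xs \<in> rint (induced B ?C) R" using hR hE by (auto simp: subset_iff)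
      from tuples_withinD(1)[OF within R this]
      have "set (map h xs) \<subseteq> X \<or> set (map h xs) \<subseteq> Y" by simp
      then show "\<exists>S\<in>{?X, ?Y}. set xs \<subseteq> S" using xs by auto
    next
      fix F xs y assume F: "F \<in> Funs L" and xs: "xs \<in> tuples (verts (induced A E)) (far L F)"
        and y: "y \<in> fint (induced A E) F xs"
      have "map h xs \<in> tuples (verts (induced B ?C)) (far L F)"
        using xs hE by (auto simp: tuples_def)
      moreover have "h y \<in> fint (induced B ?C) F (map h xs)" using hF[OF F] xs y by simp
      ultimately have "set (map h xs) \<union> {h y} \<subseteq> X \<or> set (map h xs) \<union> {h y} \<subseteq> Y"
        using tuples_withinD(2)[OF within F, of "map h xs" "h y"] by auto
      moreover have "set xs \<subseteq> E" "y \<in> E"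
        using xs y substructureD[OF EA F] by (auto simp: tuples_def)
      ultimately show "\<exists>S\<in>{?X, ?Y}. set (xs @ [y]) \<subseteq> S" by auto
    qed
    moreover have "?X \<union> ?Y = E" using hE XY by auto
    ultimately have "?X = E \<or> ?Y = E" using irreducible_subD[OF A E sub[OF X] sub[OF Y]] by blast
    then have "h ` E \<subseteq> X \<or> h ` E \<subseteq> Y" by auto
    then have "?C \<subseteq> X \<or> ?C \<subseteq> Y" using closure_minimal X Y by metis
    then show ?thesis using XY by blast
  qed
  then show ?thesis using C by (auto simp: irreducible_sub_iff[OF B])
qed

section \<open>Partite systems over an ambient structure\<close>

locale ambient_structure =
  fixes L :: "('r, 'f) lang" and D :: "('d, 'r, 'f) struct" and \<B> :: "'d set set"
  assumes finite_D: "finite (verts D)" and D: "L_structure L D"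
begin

abbreviation LP :: "('r + 'd, 'f) lang" where "LP \<equiv> pred_lang L (verts D)"

text \<open>\<open>\<B>\<close> is instantiated with the vertex sets of the copies of \<open>B\<close> in \<open>D\<close>.\<close>

definition partite_over :: "('v, 'r + 'd, 'f) struct \<Rightarrow> ('v \<Rightarrow> 'd) \<Rightarrow> bool" where
  "partite_over P \<pi> \<longleftrightarrow> finite (verts P) \<and> L_structure LP P \<and>
     (\<forall>v\<in>verts P. \<pi> v \<in> verts D \<and> (\<forall>p\<in>verts D. [v] \<in> rint P (Inr p) \<longleftrightarrow> \<pi> v = p)) \<and>
     (\<forall>R\<in>Rels L. \<forall>xs\<in>rint P (Inl R). inj_on \<pi> (set xs)) \<and>
     hom_where_defined L (reduct P) D \<pi> \<and>
     (\<forall>E. irreducible_sub L E (reduct P) \<longrightarrow>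
        embedding L (induced (reduct P) E) D \<pi> \<and> (\<exists>B'\<in>\<B>. \<pi> ` E \<subseteq> B'))"

lemma partite_overD:
  assumes "partite_over P \<pi>"
  shows "finite (verts P)" "L_structure LP P" "L_structure L (reduct P)"
    "\<And>v. v \<in> verts P \<Longrightarrow> \<pi> v \<in> verts D"
    "\<And>v p. v \<in> verts P \<Longrightarrow> p \<in> verts D \<Longrightarrow> [v] \<in> rint P (Inr p) \<longleftrightarrow> \<pi> v = p"
    "\<And>R xs. R \<in> Rels L \<Longrightarrow> xs \<in> rint P (Inl R) \<Longrightarrow> inj_on \<pi> (set xs)"
    "\<And>R xs. R \<in> Rels L \<Longrightarrow> xs \<in> rint P (Inl R) \<Longrightarrow> map \<pi> xs \<in> rint D R"
    "\<And>F xs. F \<in> Funs L \<Longrightarrow> xs \<in> tuples (verts P) (far L F) \<Longrightarrow> fint P F xs \<noteq> {} \<Longrightarrow>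
      \<pi> ` fint P F xs = fint D F (map \<pi> xs)"
    "\<And>E. irreducible_sub L E (reduct P) \<Longrightarrow> embedding L (induced (reduct P) E) D \<pi>"
    "\<And>E. irreducible_sub L E (reduct P) \<Longrightarrow> \<exists>B'\<in>\<B>. \<pi> ` E \<subseteq> B'"
  using assms L_structure_reduct[of L "verts D" P]
  by (simp_all add: partite_over_def hom_where_defined_def)

lemma partite_overI:
  assumes "finite (verts P)" "L_structure LP P"
    "\<And>v. v \<in> verts P \<Longrightarrow> \<pi> v \<in> verts D"
    "\<And>v p. v \<in> verts P \<Longrightarrow> p \<in> verts D \<Longrightarrow> [v] \<in> rint P (Inr p) \<longleftrightarrow> \<pi> v = p"
    "\<And>R xs. R \<in> Rels L \<Longrightarrow> xs \<in> rint P (Inl R) \<Longrightarrow> inj_on \<pi> (set xs)"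
    "\<And>R xs. R \<in> Rels L \<Longrightarrow> xs \<in> rint P (Inl R) \<Longrightarrow> map \<pi> xs \<in> rint D R"
    "\<And>F xs. F \<in> Funs L \<Longrightarrow> xs \<in> tuples (verts P) (far L F) \<Longrightarrow> fint P F xs \<noteq> {} \<Longrightarrow>
      \<pi> ` fint P F xs = fint D F (map \<pi> xs)"
    "\<And>E. irreducible_sub L E (reduct P) \<Longrightarrow> embedding L (induced (reduct P) E) D \<pi>"
    "\<And>E. irreducible_sub L E (reduct P) \<Longrightarrow> \<exists>B'\<in>\<B>. \<pi> ` E \<subseteq> B'"
  shows "partite_over P \<pi>"
  using assms by (auto simp: partite_over_def hom_where_defined_def)

text \<open>The invariant mentions an arbitrary map, since in powers and glued systems the
  projection is given by a formula. This lemma leads back to \<open>projection\<close>, which agrees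
  with that map on the vertices.\<close>

lemma partite_over_cong:
  assumes P: "partite_over P \<pi>" and eq: "\<And>v. v \<in> verts P \<Longrightarrow> \<pi> v = \<pi>' v"
  shows "partite_over P \<pi>'"
proof -
  note p = partite_overD[OF P]
  have m: "map \<pi>' xs = map \<pi> xs" if "set xs \<subseteq> verts P" for xs
    using that eq by (auto simp: subset_iff)
  have Rsub: "set xs \<subseteq> verts P" if "R \<in> Rels L" "xs \<in> rint P (Inl R)" for R xs
    using L_structure_rint[OF p(2), of "Inl R" xs] that by auto
  show ?thesis
  proof (rule partite_overI[OF p(1,2)])
    show "\<pi>' v \<in> verts D" if "v \<in> verts P" for v using p(4) that eq by auto
    show "[v] \<in> rint P (Inr p) \<longleftrightarrow> \<pi>' v = p" if "v \<in> verts P" "p \<in> verts D" for v p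
      using p(5)[OF that] eq[OF that(1)] by simp
    show "inj_on \<pi>' (set xs)" if "R \<in> Rels L" "xs \<in> rint P (Inl R)" for R xs
      using p(6)[OF that] Rsub[OF that] eq by (metis inj_on_cong subsetD)
    show "map \<pi>' xs \<in> rint D R" if "R \<in> Rels L" "xs \<in> rint P (Inl R)" for R xs
      using p(7)[OF that] m[OF Rsub[OF that]] by metis
    show "\<pi>' ` fint P F xs = fint D F (map \<pi>' xs)"
      if F: "F \<in> Funs L" and xs: "xs \<in> tuples (verts P) (far L F)" and "fint P F xs \<noteq> {}" for F xs
    proof -
      have "fint P F xs \<subseteq> verts P" using L_structure_fint[OF p(2)] F xs by simp
      then have "\<pi>' ` fint P F xs = \<pi> ` fint P F xs" using eq by (intro image_cong) auto
      moreover have "map \<pi>' xs = map \<pi> xs" using xs m unfolding tuples_def by blast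
      ultimately show ?thesis using p(8)[OF that] by metis
    qed
    fix E assume E: "irreducible_sub L E (reduct P)"
    then have sub: "substructure L E (reduct P)" by (simp add: irreducible_sub_def)
    then have EP: "E \<subseteq> verts P" using substructure_subset by fastforce
    show "embedding L (induced (reduct P) E) D \<pi>'"
      using p(9)[OF E] eq EP
      by (subst embedding_cong[OF L_structure_induced[OF p(3) sub], of _ \<pi>]) (auto simp: subset_iff)
    show "\<exists>B'\<in>\<B>. \<pi>' ` E \<subseteq> B'" using p(10)[OF E] EP eq by (metis image_cong subsetD)
  qed
qed

section \<open>Projections, restrictions, images and unions of partite systems\<close>

lemma part_eq:
  "partite_over P \<pi> \<Longrightarrow> p \<in> verts D \<Longrightarrow> part P p = {v \<in> verts P. \<pi> v = p}"
  by (auto simp: part_def partite_overD(5))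

lemma projection_eq:
  assumes P: "partite_over P \<pi>" and v: "v \<in> verts P"
  shows "projection (verts D) P v = \<pi> v"
  unfolding projection_def
proof (rule the_equality)
  show "\<pi> v \<in> verts D \<and> v \<in> part P (\<pi> v)"
    using v partite_overD(4)[OF P v] by (simp add: part_eq[OF P])
  show "p = \<pi> v" if "p \<in> verts D \<and> v \<in> part P p" for p
    using that part_eq[OF P] by auto
qed

lemma D_partite:
  assumes P: "partite_over P \<pi>"
  shows "D_partite L D P"
proof -
  have proj: "partite_over P (projection (verts D) P)"
    by (rule partite_over_cong[OF P]) (simp add: projection_eq[OF P])
  note p = partite_overD[OF P] and q = partite_overD[OF proj]
  have "partite_system L (verts D) P"
    unfolding partite_system_def
  proof (intro conjI ballI impI)
    show "finite (verts D)" "L_structure LP P" "finite (verts P)" by (fact finite_D p(2) p(1))+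
    show "\<exists>!p. p \<in> verts D \<and> v \<in> part P p" if "v \<in> verts P" for v
    proof (rule ex1I[of _ "\<pi> v"])
      show "\<pi> v \<in> verts D \<and> v \<in> part P (\<pi> v)" using that p(4) by (simp add: part_eq[OF P])
    qed (use that part_eq[OF P] in auto)
    fix d R xs x y
    assume "d \<in> verts D" "R \<in> Rels L" "xs \<in> rint P (Inl R)" "x \<in> set xs" "y \<in> set xs"
      "x \<in> part P d" "y \<in> part P d"
    then show "x = y" using p(6)[of R xs] part_eq[OF P] by (auto simp: inj_on_def)
  qed
  moreover have "hom_embedding L (reduct P) D (projection (verts D) P)"
    using proj by (simp add: hom_embedding_def partite_over_def)
  ultimately show ?thesis by (simp add: D_partite_def)
qed

text \<open>An irreducible substructure of a substructure is one of the whole system, so the clauses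
  about irreducible substructures are inherited.\<close>

lemma partite_over_induced:
  assumes P: "partite_over P \<pi>" and X: "substructure L X (reduct P)"
  shows "partite_over (induced P X) \<pi>"
proof -
  note p = partite_overD[OF P]
  have XP: "X \<subseteq> verts P" using substructure_subset[OF X] by simp
  have X': "substructure LP X P" using X by (simp add: substructure_reduct)
  have irr: "irreducible_sub L E (reduct P) \<and> induced (reduct (induced P X)) E = induced (reduct P) E"
    if "irreducible_sub L E (reduct (induced P X))" for E
  proof -
    have "E \<subseteq> X" using that substructure_subset by (fastforce simp: irreducible_sub_def)
    then have "irreducible_sub L E (reduct P)"
      using that irreducible_sub_induced[OF p(3) X, of E] by (simp add: induced_reduct)
    moreover have "induced (reduct (induced P X)) E = induced (reduct P) E"
      using \<open>E \<subseteq> X\<close> by (auto simp: induced_def reduct_def)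
    ultimately show ?thesis by blast
  qed
  show ?thesis
  proof (rule partite_overI)
    show "finite (verts (induced P X))" using p(1) XP finite_subset by auto
    show "L_structure LP (induced P X)" by (rule L_structure_induced[OF p(2) X'])
    show "\<pi> ` fint (induced P X) F xs = fint D F (map \<pi> xs)"
      if "F \<in> Funs L" "xs \<in> tuples (verts (induced P X)) (far L F)" "fint (induced P X) F xs \<noteq> {}" for F xs
      using p(8)[of F xs] that XP by (auto simp: tuples_def)
    show "embedding L (induced (reduct (induced P X)) E) D \<pi>" "\<exists>B'\<in>\<B>. \<pi> ` E \<subseteq> B'"
      if "irreducible_sub L E (reduct (induced P X))" for E
      using irr[OF that] p(9,10) by auto
  qed (use p XP in auto)
qed

text \<open>The closure of a tuple with non-empty value is irreducible, since that tuple together with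
  any of its values has to lie inside one of two substructures forming a free amalgam.\<close>

lemma inj_on_fint:
  assumes P: "partite_over P \<pi>" and F: "F \<in> Funs L" and xs: "xs \<in> tuples (verts P) (far L F)"
  shows "inj_on \<pi> (fint P F xs)"
proof (cases "fint P F xs = {}")
  case False
  note p = partite_overD[OF P]
  let ?E = "closure L (reduct P) (set xs)"
  have E: "irreducible_sub L ?E (reduct P)"
    using irreducible_closure_of_tuple[OF p(3) F, of xs] xs False by simp
  have sub: "substructure L ?E (reduct P)" using E by (simp add: irreducible_sub_def)
  have "inj_on \<pi> ?E"
    using embeddingD(1)[OF L_structure_induced[OF p(3) sub] p(9)[OF E]] by simp
  moreover have "fint P F xs \<subseteq> ?E"
  proof -
    have "xs \<in> tuples ?E (far L F)" using xs subset_closure by (fastforce simp: tuples_def)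
    then show ?thesis using substructureD[OF sub F] by auto
  qed
  ultimately show ?thesis by (rule inj_on_subset)
qed simp

text \<open>Where a value occurs at all, the projection satisfies the function equation; the value
  then projects to a value in \<open>D\<close>, which stays in \<open>S\<close>. This makes the
  restriction of a system a substructure.\<close>

lemma substructure_preimage:
  assumes P: "partite_over P \<pi>" and S: "substructure L S D"
  shows "substructure L {v \<in> verts P. \<pi> v \<in> S} (reduct P)"
  unfolding substructure_def
proof (intro conjI ballI subsetI)
  note p = partite_overD[OF P]
  show "v \<in> verts (reduct P)" if "v \<in> {v \<in> verts P. \<pi> v \<in> S}" for v using that by simp
  fix F xs y assume F: "F \<in> Funs L" and xs: "xs \<in> tuples {v \<in> verts P. \<pi> v \<in> S} (far L F)"
    and y: "y \<in> fint (reduct P) F xs"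
  have xsP: "xs \<in> tuples (verts P) (far L F)" and m: "map \<pi> xs \<in> tuples S (far L F)"
    using xs by (auto simp: tuples_def)
  have "\<pi> y \<in> fint D F (map \<pi> xs)" using p(8)[OF F xsP] y by auto
  then have "\<pi> y \<in> S" by (rule substructureD[OF S F m])
  moreover have "y \<in> verts P" using L_structure_fint[OF p(3) F] xsP y by auto
  ultimately show "y \<in> {v \<in> verts P. \<pi> v \<in> S}" by simp
qed

lemma restrict_system_eq:
  "partite_over P \<pi> \<Longrightarrow> restrict_system D P S = induced P {v \<in> verts P. \<pi> v \<in> S}"
  by (auto simp: restrict_system_def projection_eq intro!: arg_cong[where f = "induced P"])

lemma partite_over_restrict_system:
  "partite_over P \<pi> \<Longrightarrow> substructure L S D \<Longrightarrow> partite_over (restrict_system D P S) \<pi>"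
  by (simp add: restrict_system_eq partite_over_induced substructure_preimage)

text \<open>Predicates are symbols of \<open>LP\<close> and each vertex satisfies just one of them,
  so an embedding in the expanded language has no choice.\<close>

lemma embedding_projection:
  assumes P: "partite_over P \<pi>" and Q: "partite_over Q \<pi>'" and f: "embedding LP P Q f"
    and v: "v \<in> verts P"
  shows "\<pi>' (f v) = \<pi> v"
proof -
  note f = embeddingD[OF partite_overD(2)[OF P] f]
  have "[v] \<in> rint P (Inr (\<pi> v))" using partite_overD(4,5)[OF P] v by simp
  then have "[f v] \<in> rint Q (Inr (\<pi> v))"
    using f(3)[of "Inr (\<pi> v)" "[v]"] v partite_overD(4)[OF P] by simp
  then show ?thesis using partite_overD(5)[OF Q, of "f v" "\<pi> v"] f(2) v partite_overD(4)[OF P] by auto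
qed

text \<open>Irreducible substructures are handled through the closure of their image, on which the
  projection is an embedding.\<close>

lemma partite_over_image:
  assumes M: "partite_over M \<pi>" and f: "embedding LP M Q f"
    and \<pi>': "\<And>v. v \<in> verts M \<Longrightarrow> \<pi>' (f v) = \<pi> v"
  shows "partite_over (induced Q (f ` verts M)) \<pi>'"
proof -
  note m = partite_overD[OF M]
  let ?I = "induced Q (f ` verts M)"
  define g where "g = inv_into (verts M) f"
  have I: "L_structure LP ?I" by (rule L_structure_image[OF m(2) f])
  have IL: "L_structure L (reduct ?I)" by (rule L_structure_reduct[OF I])
  have g: "embedding LP ?I M g" unfolding g_def by (rule embedding_inv[OF m(2) f])
  have gL: "embedding L (reduct ?I) (reduct M) g" by (rule embedding_reduct[OF I g])
  note gD = embeddingD[OF I g] and gLD = embeddingD[OF IL gL]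
  have gv: "g v \<in> verts M" "\<pi> (g v) = \<pi>' v" if "v \<in> verts ?I" for v
    using that \<pi>' embeddingD(1)[OF m(2) f] by (auto simp: g_def)
  have mg: "map \<pi>' xs = map \<pi> (map g xs)" if "set xs \<subseteq> verts ?I" for xs
    using that gv(2) by (auto simp: subset_iff)
  have RI: "set xs \<subseteq> verts ?I" "map g xs \<in> rint M (Inl R)"
    if "R \<in> Rels L" "xs \<in> rint ?I (Inl R)" for R xs
  proof -
    show "set xs \<subseteq> verts ?I" using that by simp
    then show "map g xs \<in> rint M (Inl R)" using gD(3)[of "Inl R" xs] that by simp
  qed
  show ?thesis
  proof (rule partite_overI)
    show "finite (verts ?I)" using m(1) by simp
    show "L_structure LP ?I" by (rule I)
    show "\<pi>' v \<in> verts D" if "v \<in> verts ?I" for v using m(4) gv[OF that] by metis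
    show "[v] \<in> rint ?I (Inr p) \<longleftrightarrow> \<pi>' v = p" if "v \<in> verts ?I" "p \<in> verts D" for v p
      using gD(3)[of "Inr p" "[v]"] m(5)[OF gv(1)[OF that(1)] that(2)] gv(2)[OF that(1)] that by simp
    show "inj_on \<pi>' (set xs)" if "R \<in> Rels L" "xs \<in> rint ?I (Inl R)" for R xs
    proof -
      have "inj_on \<pi> (g ` set xs)" using m(6)[OF that(1) RI(2)[OF that]] by simp
      moreover have "inj_on g (set xs)" using gD(1) RI(1)[OF that] by (rule inj_on_subset)
      ultimately have "inj_on (\<pi> \<circ> g) (set xs)" by (simp add: comp_inj_on)
      then show ?thesis using RI(1)[OF that] gv(2) by (auto simp: inj_on_def subset_iff)
    qed
    show "map \<pi>' xs \<in> rint D R" if "R \<in> Rels L" "xs \<in> rint ?I (Inl R)" for R xs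
      unfolding mg[OF RI(1)[OF that]] by (rule m(7)[OF that(1) RI(2)[OF that]])
    show "\<pi>' ` fint ?I F xs = fint D F (map \<pi>' xs)"
      if F: "F \<in> Funs L" and xs: "xs \<in> tuples (verts ?I) (far L F)" and ne: "fint ?I F xs \<noteq> {}" for F xs
    proof -
      have gf: "fint M F (map g xs) = g ` fint ?I F xs" using gD(4)[of F xs] F xs by simp
      have "map g xs \<in> tuples (verts M) (far L F)" using tuples_map[OF gD(2) xs] .
      then have "\<pi> ` fint M F (map g xs) = fint D F (map \<pi> (map g xs))"
        using m(8)[OF F] gf ne by blast
      moreover have "fint ?I F xs \<subseteq> verts ?I" using L_structure_fint[OF I, of F xs] F xs by simp
      then have "\<pi> ` g ` fint ?I F xs = \<pi>' ` fint ?I F xs"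
        using gv(2) by (auto simp: image_image intro!: image_cong)
      moreover have "map \<pi>' xs = map \<pi> (map g xs)" using mg[of xs] xs unfolding tuples_def by blast
      ultimately show ?thesis using gf by metis
    qed
    fix E assume E: "irreducible_sub L E (reduct ?I)"
    have sub: "substructure L E (reduct ?I)" using E by (simp add: irreducible_sub_def)
    have EI: "E \<subseteq> verts ?I" using substructure_subset[OF sub] by simp
    let ?C = "closure L (reduct M) (g ` E)"
    have C: "irreducible_sub L ?C (reduct M)"
    proof (rule irreducible_closure_of_hom_image[OF IL m(3) E])
      show "g ` E \<subseteq> verts (reduct M)" using gv(1) EI by auto
      show "map g xs \<in> rint (reduct M) R"
        if "R \<in> Rels L" "xs \<in> rint (reduct ?I) R" "set xs \<subseteq> E" for R xs
        using RI(2)[OF that(1)] that(2) by simp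
      show "g y \<in> fint (reduct M) F (map g xs)"
        if "F \<in> Funs L" "xs \<in> tuples E (far L F)" "y \<in> fint (reduct ?I) F xs" for F xs y
        using gLD(4)[of F xs] that EI by (auto simp: tuples_def)
    qed
    have subC: "substructure L ?C (reduct M)" using C by (simp add: irreducible_sub_def)
    have EL: "L_structure L (induced (reduct ?I) E)" by (rule L_structure_induced[OF IL sub])
    have "embedding L (induced (reduct ?I) E) (reduct M) g"
      using embedding_comp[OF EL IL embedding_inclusion[OF IL sub] gL] .
    then have "embedding L (induced (reduct ?I) E) (induced (reduct M) ?C) g"
      by (rule embedding_into_induced[OF EL]) (simp add: subset_closure)
    then have "embedding L (induced (reduct ?I) E) D (\<lambda>v. \<pi> (g v))"
      by (rule embedding_comp[OF EL L_structure_induced[OF m(3) subC] _ m(9)[OF C]])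
    then show "embedding L (induced (reduct ?I) E) D \<pi>'"
      by (subst embedding_cong[OF EL, of \<pi>' "\<lambda>v. \<pi> (g v)"]) (use EI gv(2) in auto)
    obtain B' where "B' \<in> \<B>" "\<pi> ` ?C \<subseteq> B'" using m(10)[OF C] by blast
    moreover have "\<pi>' ` E \<subseteq> \<pi> ` ?C"
    proof
      fix d assume "d \<in> \<pi>' ` E"
      then obtain v where v: "v \<in> E" "d = \<pi>' v" by blast
      then have "g v \<in> ?C" using subset_closure by fast
      moreover have "\<pi> (g v) = d" using v gv(2) EI by auto
      ultimately show "d \<in> \<pi> ` ?C" by blast
    qed
    ultimately show "\<exists>B'\<in>\<B>. \<pi>' ` E \<subseteq> B'" by (metis order_trans)
  qed
qed

text \<open>Each clause of the invariant can be checked inside one member: relation tuples and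
  tuples with a value lie in a member by \<open>within\<close>, irreducible substructures by
  \<open>irreducible_sub_in_part\<close>. The core has to lie in a member too, for the irreducible
  substructures inside it. Applied with the empty core to the disjoint union, and with the power as
  core to the free extension.\<close>

lemma partite_over_union:
  assumes Q: "L_structure LP Q" and fin: "finite (verts Q)"
    and within: "tuples_within LP Q \<S>" and cover: "verts Q = \<Union>\<S>"
    and sub: "\<And>S. S \<in> \<S> \<Longrightarrow> substructure LP S Q"
    and parts: "\<And>S. S \<in> \<S> \<Longrightarrow> partite_over (induced Q S) \<pi>"
    and K: "substructure LP K Q" "\<exists>S\<in>\<S>. K \<subseteq> S"
    and core: "\<And>S S'. S \<in> \<S> \<Longrightarrow> S' \<in> \<S> \<Longrightarrow> S \<noteq> S' \<Longrightarrow> S \<inter> S' \<subseteq> K"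
  shows "partite_over Q \<pi>"
proof -
  note QL = L_structure_reduct[OF Q]
  have withinL: "tuples_within L (reduct Q) \<S>"
    using within by (simp add: tuples_within_def ball_Un)
  have relation: "\<exists>S\<in>\<S>. xs \<in> rint (induced Q S) (Inl R)"
    if "R \<in> Rels L" "xs \<in> rint Q (Inl R)" for R xs
    using tuples_withinD(1)[OF withinL that(1), of xs] that by auto
  show ?thesis
  proof (rule partite_overI[OF fin Q])
    show "\<pi> v \<in> verts D" if "v \<in> verts Q" for v
      using that cover partite_overD(4)[OF parts] by auto
    show "[v] \<in> rint Q (Inr p) \<longleftrightarrow> \<pi> v = p" if v: "v \<in> verts Q" and p: "p \<in> verts D" for v p
    proof -
      obtain S where S: "S \<in> \<S>" "v \<in> S" using v cover by blast
      show ?thesis using partite_overD(5)[OF parts[OF S(1)], of v p] S p by simp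
    qed
    show "inj_on \<pi> (set xs)" "map \<pi> xs \<in> rint D R"
      if R: "R \<in> Rels L" and xs: "xs \<in> rint Q (Inl R)" for R xs
      using relation[OF that] partite_overD(6,7)[OF parts R, of _ xs] by blast+
    show "\<pi> ` fint Q F xs = fint D F (map \<pi> xs)"
      if F: "F \<in> Funs L" and xs: "xs \<in> tuples (verts Q) (far L F)" and ne: "fint Q F xs \<noteq> {}" for F xs
    proof -
      obtain y where "y \<in> fint Q F xs" using ne by blast
      then obtain S where S: "S \<in> \<S>" "set xs \<subseteq> S"
        using tuples_withinD(2)[OF withinL F, of xs y] xs by auto
      then show ?thesis using partite_overD(8)[OF parts[OF S(1)] F, of xs] xs ne
        by (simp add: tuples_def)
    qed
    fix E assume E: "irreducible_sub L E (reduct Q)"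
    have "E \<subseteq> K \<or> (\<exists>S\<in>\<S>. E \<subseteq> S)"
      by (rule irreducible_sub_in_part[OF QL E withinL])
        (use cover sub K core in \<open>auto simp: substructure_reduct\<close>)
    then obtain S where S: "S \<in> \<S>" "E \<subseteq> S" using K(2) by blast
    have subS: "substructure L S (reduct Q)" using sub[OF S(1)] by (simp add: substructure_reduct)
    have irr: "irreducible_sub L E (reduct (induced Q S))"
      using irreducible_sub_induced[OF QL subS S(2)] E by (simp add: induced_reduct)
    have eq: "induced (reduct (induced Q S)) E = induced (reduct Q) E"
      using S(2) by (auto simp: induced_def reduct_def)
    show "embedding L (induced (reduct Q) E) D \<pi>" "\<exists>B'\<in>\<B>. \<pi> ` E \<subseteq> B'"
      using partite_overD(9,10)[OF parts[OF S(1)] irr] unfolding eq by auto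
  qed
qed

end

section \<open>Powers and expansions\<close>

lemma power_system_simps [simp]:
  "xs \<in> rint (power_system D P N) R \<longleftrightarrow>
    set xs \<subseteq> verts (power_system D P N) \<and> (\<forall>i<N. map (\<lambda>x. x i) xs \<in> rint P R)"
  "y \<in> fint (power_system D P N) F xs \<longleftrightarrow>
    y \<in> verts (power_system D P N) \<and> (\<forall>i<N. y i \<in> fint P F (map (\<lambda>x. x i) xs))"
  by (auto simp: power_system_def Let_def)

context ambient_structure
begin

text \<open>For positive \<open>N\<close> the predicate of a vertex of the power can be read off at
  coordinate 0, which eliminates the quantifier over predicates.\<close>

lemma verts_power_system:
  assumes P: "partite_over P \<pi>" and N: "0 < N"
  shows "x \<in> verts (power_system D P N) \<longleftrightarrow>
    x \<in> extensional {..<N} \<and> (\<forall>i<N. x i \<in> verts P \<and> \<pi> (x i) = \<pi> (x 0))"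
proof -
  have "x \<in> verts (power_system D P N) \<longleftrightarrow> (\<exists>p\<in>verts D. x \<in> {..<N} \<rightarrow>\<^sub>E part P p)"
    by (simp add: power_system_def Let_def)
  also have "\<dots> \<longleftrightarrow> (\<exists>p\<in>verts D. x \<in> extensional {..<N} \<and> (\<forall>i<N. x i \<in> verts P \<and> \<pi> (x i) = p))"
    by (auto simp: part_eq[OF P] PiE_iff)
  also have "\<dots> \<longleftrightarrow> x \<in> extensional {..<N} \<and> (\<forall>i<N. x i \<in> verts P \<and> \<pi> (x i) = \<pi> (x 0))"
    using N partite_overD(4)[OF P] by metis
  finally show ?thesis .
qed

text \<open>All coordinates of a vertex share one projection. Where the projection is an embedding
  in every factor, it therefore determines the vertex and detects the relations of the
  power.\<close>

lemma partite_over_power_system: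
  assumes P: "partite_over P \<pi>" and N: "0 < N"
  shows "partite_over (power_system D P N) (\<lambda>x. \<pi> (x 0))"
proof -
  note p = partite_overD[OF P]
  let ?C = "power_system D P N"
  have vC: "x i \<in> verts P" "\<pi> (x i) = \<pi> (x 0)" if "x \<in> verts ?C" "i < N" for x i
    using that unfolding verts_power_system[OF P N] by blast+
  have eC: "x \<in> extensional {..<N}" if "x \<in> verts ?C" for x
    using that unfolding verts_power_system[OF P N] by blast
  have extC: "x = y" if "x \<in> verts ?C" "y \<in> verts ?C" "\<And>i. i < N \<Longrightarrow> x i = y i" for x y
    using extensionalityI[OF eC[OF that(1)] eC[OF that(2)]] that(3) by simp
  have mC: "map \<pi> (map (\<lambda>x. x i) xs) = map (\<lambda>x. \<pi> (x 0)) xs"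
    if "set xs \<subseteq> verts ?C" "i < N" for xs i
  proof -
    have "\<pi> (x i) = \<pi> (x 0)" if "x \<in> set xs" for x
      using vC(2)[of x i] that \<open>set xs \<subseteq> verts ?C\<close> \<open>i < N\<close> by blast
    then show ?thesis unfolding map_map o_def by (rule map_cong[OF refl])
  qed
  have tC: "map (\<lambda>x. x i) xs \<in> tuples (verts P) n" if "xs \<in> tuples (verts ?C) n" "i < N" for xs i n
    using that vC(1) by (auto simp: tuples_def)
  have C: "L_structure LP ?C"
    unfolding L_structure_def
  proof (intro conjI ballI subsetI)
    fix R xs assume R: "R \<in> Rels LP" and xs: "xs \<in> rint ?C R"
    then have "map (\<lambda>x. x 0) xs \<in> rint P R" using N by simp
    from L_structure_length[OF p(2) R this] xs
    show "xs \<in> tuples (verts ?C) (rar LP R)" by (simp add: tuples_def)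
  qed simp
  note CL = L_structure_reduct[OF C]
  \<comment> \<open>A value in \<open>D\<close> lifts separately in each coordinate, and the lifts
    have a common projection, so together they form a vertex of the power. The coordinatewise
    hypothesis \<open>eq\<close> is available for non-empty values and, inside irreducible
    substructures, for empty ones as well.\<close>
  have fintC: "(\<lambda>x. \<pi> (x 0)) ` fint ?C F xs = fint D F (map (\<lambda>x. \<pi> (x 0)) xs)"
    if F: "F \<in> Funs L" and xs: "xs \<in> tuples (verts ?C) (far L F)"
      and eq: "\<And>i. i < N \<Longrightarrow> \<pi> ` fint P F (map (\<lambda>x. x i) xs) = fint D F (map (\<lambda>x. \<pi> (x 0)) xs)"
    for F xs
  proof (intro equalityI subsetI)
    fix d assume "d \<in> (\<lambda>x. \<pi> (x 0)) ` fint ?C F xs"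
    then show "d \<in> fint D F (map (\<lambda>x. \<pi> (x 0)) xs)" using eq[OF N] N by auto
  next
    fix d assume d: "d \<in> fint D F (map (\<lambda>x. \<pi> (x 0)) xs)"
    have "\<exists>y. y \<in> fint P F (map (\<lambda>x. x i) xs) \<and> \<pi> y = d" if "i < N" for i
      using eq[OF that] d by (metis (no_types, lifting) imageE)
    then obtain y where y: "\<And>i. i < N \<Longrightarrow> y i \<in> fint P F (map (\<lambda>x. x i) xs) \<and> \<pi> (y i) = d"
      by metis
    have "y i \<in> verts P" if "i < N" for i
      using y[OF that] L_structure_fint[OF p(2), of F] tC[OF xs that] F by auto
    then have "restrict y {..<N} \<in> verts ?C" using y N by (simp add: verts_power_system[OF P N])
    then have "restrict y {..<N} \<in> fint ?C F xs" using y by simp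
    moreover have "d = \<pi> (restrict y {..<N} 0)" using y N by simp
    ultimately show "d \<in> (\<lambda>x. \<pi> (x 0)) ` fint ?C F xs" by blast
  qed
  show ?thesis
  proof (rule partite_overI[OF _ C])
    have "verts ?C \<subseteq> {..<N} \<rightarrow>\<^sub>E verts P" using vC(1) eC unfolding PiE_iff subset_iff by blast
    then show "finite (verts ?C)" using p(1) by (meson finite_PiE finite_lessThan finite_subset)
    show "\<pi> (x 0) \<in> verts D" if "x \<in> verts ?C" for x using p(4) vC(1)[OF that N] .
    show "[x] \<in> rint ?C (Inr d) \<longleftrightarrow> \<pi> (x 0) = d" if x: "x \<in> verts ?C" and d: "d \<in> verts D" for x d
    proof -
      have "[x i] \<in> rint P (Inr d) \<longleftrightarrow> \<pi> (x 0) = d" if "i < N" for i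
        using p(5)[OF vC(1)[OF x that] d] unfolding vC(2)[OF x that] .
      then show ?thesis using x N by auto
    qed
    show "inj_on (\<lambda>x. \<pi> (x 0)) (set xs)" if R: "R \<in> Rels L" and xs: "xs \<in> rint ?C (Inl R)" for R xs
    proof (rule inj_onI)
      fix x y assume xy: "x \<in> set xs" "y \<in> set xs" "\<pi> (x 0) = \<pi> (y 0)"
      have C: "x \<in> verts ?C" "y \<in> verts ?C" using xs xy by auto
      show "x = y"
      proof (rule extC[OF C])
        fix i assume i: "i < N"
        have "inj_on \<pi> (set (map (\<lambda>x. x i) xs))" using p(6)[OF R, of "map (\<lambda>x. x i) xs"] xs i by simp
        moreover have "\<pi> (x i) = \<pi> (y i)" using vC(2)[OF C(1) i] vC(2)[OF C(2) i] xy by simp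
        ultimately show "x i = y i" using xy by (auto dest: inj_onD)
      qed
    qed
    show "map (\<lambda>x. \<pi> (x 0)) xs \<in> rint D R" if R: "R \<in> Rels L" and xs: "xs \<in> rint ?C (Inl R)" for R xs
      using p(7)[OF R, of "map (\<lambda>x. x 0) xs"] xs N by (simp add: o_def)
    show "(\<lambda>x. \<pi> (x 0)) ` fint ?C F xs = fint D F (map (\<lambda>x. \<pi> (x 0)) xs)"
      if F: "F \<in> Funs L" and xs: "xs \<in> tuples (verts ?C) (far L F)" and ne: "fint ?C F xs \<noteq> {}" for F xs
    proof (rule fintC[OF F xs])
      fix i assume i: "i < N"
      have xsC: "set xs \<subseteq> verts ?C" using xs by (simp add: tuples_def)
      have "fint P F (map (\<lambda>x. x i) xs) \<noteq> {}" using ne i by (metis ex_in_conv power_system_simps(2))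
      from p(8)[OF F tC[OF xs i] this]
      show "\<pi> ` fint P F (map (\<lambda>x. x i) xs) = fint D F (map (\<lambda>x. \<pi> (x 0)) xs)"
        unfolding mC[OF xsC i] .
    qed
    fix E assume E: "irreducible_sub L E (reduct ?C)"
    have sub: "substructure L E (reduct ?C)" using E by (simp add: irreducible_sub_def)
    have EC: "E \<subseteq> verts ?C" using substructure_subset[OF sub] by simp
    \<comment> \<open>The coordinates of \<open>E\<close> need not form a substructure, since a
      factor may have values that extend to no value of the power. Hence the closure.\<close>
    define K where "K i = closure L (reduct P) ((\<lambda>x. x i) ` E)" for i
    have K: "irreducible_sub L (K i) (reduct P)" if "i < N" for i
      unfolding K_def
    proof (rule irreducible_closure_of_hom_image[OF CL p(3) E])
      show "(\<lambda>x. x i) ` E \<subseteq> verts (reduct P)" using vC(1) EC that by auto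
    qed (use that in auto)
    have subK: "substructure L (K i) (reduct P)" if "i < N" for i
      using K[OF that] by (simp add: irreducible_sub_def)
    have EK: "x i \<in> K i" if "x \<in> E" for x i
      using that subset_closure[of "(\<lambda>x. x i) ` E"] by (auto simp: K_def)
    note embK = embeddingD[OF L_structure_induced[OF p(3) subK] p(9)[OF K]]
    show "embedding L (induced (reduct ?C) E) D (\<lambda>x. \<pi> (x 0))"
    proof (rule embeddingI[OF L_structure_induced[OF CL sub]])
      show "inj_on (\<lambda>x. \<pi> (x 0)) (verts (induced (reduct ?C) E))"
      proof (rule inj_onI)
        fix x y assume "x \<in> verts (induced (reduct ?C) E)" "y \<in> verts (induced (reduct ?C) E)"
          and eq: "\<pi> (x 0) = \<pi> (y 0)"
        then have xy: "x \<in> E" "y \<in> E" by auto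
        then have C: "x \<in> verts ?C" "y \<in> verts ?C" using EC by auto
        show "x = y"
        proof (rule extC[OF C])
          fix i assume i: "i < N"
          have "\<pi> (x i) = \<pi> (y i)" using vC(2)[OF C(1) i] vC(2)[OF C(2) i] eq by simp
          then show "x i = y i" using embK(1)[OF i i] EK xy by (auto dest: inj_onD)
        qed
      qed
      show "(\<lambda>x. \<pi> (x 0)) ` verts (induced (reduct ?C) E) \<subseteq> verts D"
        using p(4) vC(1)[OF _ N] EC by auto
      show "map (\<lambda>x. \<pi> (x 0)) xs \<in> rint D R \<longleftrightarrow> xs \<in> rint (induced (reduct ?C) E) R"
        if R: "R \<in> Rels L" and xs: "set xs \<subseteq> verts (induced (reduct ?C) E)" for R xs
      proof -
        have xsC: "set xs \<subseteq> verts ?C" "set xs \<subseteq> E" using xs EC by auto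
        \<comment> \<open>On each \<open>K i\<close> the projection reflects relations, so a
          relation seen in \<open>D\<close> holds in all coordinates and thus in the power.\<close>
        have "map (\<lambda>x. \<pi> (x 0)) xs \<in> rint D R \<longleftrightarrow> map (\<lambda>x. x i) xs \<in> rint P (Inl R)" if i: "i < N" for i
        proof -
          have "set (map (\<lambda>x. x i) xs) \<subseteq> verts (induced (reduct P) (K i))" using EK xs by auto
          from embK(3)[OF i i R this] this show ?thesis unfolding mC[OF xsC(1) i] by simp
        qed
        then show ?thesis using xsC N by auto
      qed
      fix F xs assume F: "F \<in> Funs L" and xs: "xs \<in> tuples (verts (induced (reduct ?C) E)) (far L F)"
      have xsC: "xs \<in> tuples (verts ?C) (far L F)" and xsC': "set xs \<subseteq> verts ?C"
        using xs EC by (auto simp: tuples_def)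
      have "(\<lambda>x. \<pi> (x 0)) ` fint ?C F xs = fint D F (map (\<lambda>x. \<pi> (x 0)) xs)"
      proof (rule fintC[OF F xsC])
        fix i assume i: "i < N"
        have "map (\<lambda>x. x i) xs \<in> tuples (verts (induced (reduct P) (K i))) (far L F)"
          using xs EK by (auto simp: tuples_def)
        from embK(4)[OF i i F this]
        show "\<pi> ` fint P F (map (\<lambda>x. x i) xs) = fint D F (map (\<lambda>x. \<pi> (x 0)) xs)"
          unfolding mC[OF xsC' i] by simp
      qed
      then show "fint D F (map (\<lambda>x. \<pi> (x 0)) xs) = (\<lambda>x. \<pi> (x 0)) ` fint (induced (reduct ?C) E) F xs"
        by simp
    qed
    show "\<exists>B'\<in>\<B>. (\<lambda>x. \<pi> (x 0)) ` E \<subseteq> B'"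
      using p(10)[OF K[OF N]] EK by (auto simp: image_subset_iff)
  qed
qed

end

section \<open>A single embedded copy as a partite system\<close>

definition expansion :: "('v, 'r, 'f) struct \<Rightarrow> ('v \<Rightarrow> 'd) \<Rightarrow> ('v, 'r + 'd, 'f) struct" where
  "expansion B b = \<lparr>verts = verts B,
     rint = case_sum (rint B) (\<lambda>d. {[v] |v. v \<in> verts B \<and> b v = d}), fint = fint B\<rparr>"

lemma expansion_simps [simp]:
  "verts (expansion B b) = verts B" "fint (expansion B b) = fint B"
  "rint (expansion B b) (Inl R) = rint B R"
  "rint (expansion B b) (Inr d) = {[v] |v. v \<in> verts B \<and> b v = d}"
  by (auto simp: expansion_def)

lemma reduct_expansion [simp]: "reduct (expansion B b) = B"
  by (simp add: reduct_def expansion_def)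

context ambient_structure
begin

text \<open>The embedding serves as projection. Its injectivity makes relation tuples transversal,
  and it restricts to an embedding on every substructure, irreducible or not.\<close>

lemma partite_over_expansion:
  assumes B: "L_structure L B" and b: "embedding L B D b" and mem: "b ` verts B \<in> \<B>"
  shows "partite_over (expansion B b) b"
proof -
  note e = embeddingD[OF B b]
  show ?thesis
  proof (rule partite_overI)
    show "finite (verts (expansion B b))"
      using e(1,2) finite_D by (auto intro: inj_on_finite)
    show "L_structure LP (expansion B b)"
      using B unfolding L_structure_def by (auto simp: ball_Un tuples_def[of _ "Suc 0"])
    show "inj_on b (set xs)" if "R \<in> Rels L" "xs \<in> rint (expansion B b) (Inl R)" for R xs
      using L_structure_rint[OF B that(1), of xs] that e(1) by (auto intro: inj_on_subset)
    show "map b xs \<in> rint D R" if "R \<in> Rels L" "xs \<in> rint (expansion B b) (Inl R)" for R xs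
      using e(3)[OF that(1) L_structure_rint[OF B that(1)]] that by simp
    fix E assume "irreducible_sub L E (reduct (expansion B b))"
    then have E: "substructure L E B" by (simp add: irreducible_sub_def)
    show "embedding L (induced (reduct (expansion B b)) E) D b"
      using embedding_comp[OF L_structure_induced[OF B E] B embedding_inclusion[OF B E] b] by simp
    show "\<exists>B'\<in>\<B>. b ` E \<subseteq> B'" using mem substructure_subset[OF E] by blast
  qed (use e in auto)
qed

end

section \<open>Gluing structures along common parts\<close>

text \<open>Transport of structure along a map injective on the vertices. Arguments of functions are
  pulled back by \<open>inv_into\<close>, so values at arguments outside the image carry no
  meaning.\<close>

definition image_struct :: "('v \<Rightarrow> 'w) \<Rightarrow> ('v, 'r, 'f) struct \<Rightarrow> ('w, 'r, 'f) struct" where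
  "image_struct f A = \<lparr>verts = f ` verts A, rint = (\<lambda>R. map f ` rint A R),
     fint = (\<lambda>F ys. f ` fint A F (map (inv_into (verts A) f) ys))\<rparr>"

lemma verts_image_struct [simp]: "verts (image_struct f A) = f ` verts A"
  by (simp add: image_struct_def)

lemma embedding_image_struct:
  assumes A: "L_structure L A" and f: "inj_on f (verts A)"
  shows "embedding L A (image_struct f A) f"
proof (rule embeddingI[OF A f])
  show "map f xs \<in> rint (image_struct f A) R \<longleftrightarrow> xs \<in> rint A R"
    if R: "R \<in> Rels L" and xs: "set xs \<subseteq> verts A" for R xs
  proof
    assume "map f xs \<in> rint (image_struct f A) R"
    then obtain ys where ys: "ys \<in> rint A R" "map f xs = map f ys" by (auto simp: image_struct_def)
    have "set ys \<subseteq> verts A" by (rule L_structure_rint[OF A R ys(1)])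
    then have "inj_on f (set xs \<union> set ys)" using f xs by (auto intro: inj_on_subset)
    then show "xs \<in> rint A R" using ys map_inj_on[OF ys(2)] by simp
  qed (auto simp: image_struct_def)
  fix F xs assume F: "F \<in> Funs L" and xs: "xs \<in> tuples (verts A) (far L F)"
  have "map (inv_into (verts A) f) (map f xs) = xs"
    using f xs by (auto simp: tuples_def subset_iff intro!: map_idI)
  then show "fint (image_struct f A) F (map f xs) = f ` fint A F xs" by (simp add: image_struct_def)
qed simp

lemma L_structure_image_struct:
  assumes A: "L_structure L A" and f: "inj_on f (verts A)"
  shows "L_structure L (image_struct f A)"
proof -
  have rel: "xs \<in> rint (induced (image_struct f A) (f ` verts A)) R"
    if R: "R \<in> Rels L" and xs: "xs \<in> rint (image_struct f A) R" for R xs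
  proof -
    obtain ys where "ys \<in> rint A R" "xs = map f ys" using xs by (auto simp: image_struct_def)
    then show ?thesis using xs L_structure_rint[OF A R, of ys] by auto
  qed
  show ?thesis
    using L_structure_image[OF A embedding_image_struct[OF A f]] rel
    unfolding L_structure_def by (simp add: subset_iff)
qed

text \<open>Values are compared in full, not just inside \<open>W\<close>: arguments in an overlap
  must have the same values whichever structure they are read in.\<close>

definition agree_on :: "('r, 'f) lang \<Rightarrow> ('v, 'r, 'f) struct \<Rightarrow> ('v, 'r, 'f) struct \<Rightarrow> 'v set \<Rightarrow> bool" where
  "agree_on L M N W \<longleftrightarrow>
     (\<forall>R\<in>Rels L. \<forall>xs. set xs \<subseteq> W \<longrightarrow> (xs \<in> rint M R \<longleftrightarrow> xs \<in> rint N R)) \<and>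
     (\<forall>F\<in>Funs L. \<forall>xs\<in>tuples W (far L F). fint M F xs = fint N F xs)"

text \<open>An embedding determines the relations and values on its image, so two structures that
  contain \<open>A\<close> along the same map cannot differ there.\<close>

lemma agree_on_embedding:
  assumes A: "L_structure L A" and f: "embedding L A M f" and g: "embedding L A N f"
  shows "agree_on L M N (f ` verts A)"
proof -
  have preimage: "\<exists>xs. ys = map f xs \<and> set xs \<subseteq> verts A" if "set ys \<subseteq> f ` verts A" for ys
  proof (intro exI conjI)
    show "ys = map f (map (inv_into (verts A) f) ys)"
      using that by (auto simp: f_inv_into_f subset_iff intro!: map_idI[symmetric])
    show "set (map (inv_into (verts A) f) ys) \<subseteq> verts A"
      using that by (auto simp: subset_iff inv_into_into)
  qed
  note f = embeddingD[OF A f] and g = embeddingD[OF A g]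
  show ?thesis
    unfolding agree_on_def
  proof (intro conjI ballI allI impI)
    fix R ys assume R: "R \<in> Rels L" and "set ys \<subseteq> f ` verts A"
    then obtain xs where "ys = map f xs" "set xs \<subseteq> verts A" using preimage by blast
    then show "ys \<in> rint M R \<longleftrightarrow> ys \<in> rint N R" using f(3)[OF R] g(3)[OF R] by simp
  next
    fix F ys assume F: "F \<in> Funs L" and ys: "ys \<in> tuples (f ` verts A) (far L F)"
    then obtain xs where "ys = map f xs" "set xs \<subseteq> verts A"
      using preimage[of ys] by (auto simp: tuples_def)
    moreover from this have "xs \<in> tuples (verts A) (far L F)" using ys by (simp add: tuples_def)
    ultimately show "fint M F ys = fint N F ys" using f(4)[OF F] g(4)[OF F] by simp
  qed
qed

lemma agree_on_subset: "agree_on L M N W \<Longrightarrow> W' \<subseteq> W \<Longrightarrow> agree_on L M N W'"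
  unfolding agree_on_def tuples_def by (metis (no_types, lifting) mem_Collect_eq order_trans)

lemma agree_on_sym: "agree_on L M N W \<Longrightarrow> agree_on L N M W"
  by (simp add: agree_on_def)

lemma agree_on_trans: "agree_on L M N W \<Longrightarrow> agree_on L N K W \<Longrightarrow> agree_on L M K W"
  by (simp add: agree_on_def)

text \<open>The free union: values are collected from those members that contain all arguments, and
  arguments that fit into no member get the empty value.\<close>

definition glue :: "('k \<Rightarrow> ('v, 'r, 'f) struct) \<Rightarrow> 'k set \<Rightarrow> ('v, 'r, 'f) struct" where
  "glue M I = \<lparr>verts = (\<Union>k\<in>I. verts (M k)), rint = (\<lambda>R. \<Union>k\<in>I. rint (M k) R),
     fint = (\<lambda>F xs. \<Union>k\<in>{k \<in> I. set xs \<subseteq> verts (M k)}. fint (M k) F xs)\<rparr>"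

lemma verts_glue [simp]: "verts (glue M I) = (\<Union>k\<in>I. verts (M k))"
  by (simp add: glue_def)

text \<open>By agreement, all members that contain a given tuple contribute the same, so each member
  sits inside the union unchanged. Freeness is built into the definition.\<close>

lemma glue:
  assumes M: "\<And>k. k \<in> I \<Longrightarrow> L_structure L (M k)"
    and agree: "\<And>k l. k \<in> I \<Longrightarrow> l \<in> I \<Longrightarrow> agree_on L (M k) (M l) (verts (M k) \<inter> verts (M l))"
  shows "L_structure L (glue M I)"
    and "k \<in> I \<Longrightarrow> embedding L (M k) (glue M I) (\<lambda>v. v)"
    and "tuples_within L (glue M I) ((\<lambda>k. verts (M k)) ` I)"
proof -
  have fint_glue: "fint (glue M I) F xs = fint (M k) F xs"
    if k: "k \<in> I" and F: "F \<in> Funs L" and xs: "xs \<in> tuples (verts (M k)) (far L F)" for k F xs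
  proof -
    have "fint (M l) F xs = fint (M k) F xs" if "l \<in> I" "set xs \<subseteq> verts (M l)" for l
    proof -
      have "xs \<in> tuples (verts (M l) \<inter> verts (M k)) (far L F)" using xs that by (simp add: tuples_def)
      then show ?thesis using agree[OF that(1) k] F by (simp add: agree_on_def)
    qed
    then have "(\<Union>l\<in>{l \<in> I. set xs \<subseteq> verts (M l)}. fint (M l) F xs) =
        (\<Union>l\<in>{l \<in> I. set xs \<subseteq> verts (M l)}. fint (M k) F xs)"
      by (intro SUP_cong refl) blast
    also have "\<dots> = fint (M k) F xs" using k xs by (auto simp: tuples_def)
    finally show ?thesis by (simp add: glue_def)
  qed
  have cases: "\<exists>k\<in>I. xs \<in> tuples (verts (M k)) (far L F) \<and> y \<in> fint (M k) F xs"
    if "xs \<in> tuples (verts (glue M I)) (far L F)" "y \<in> fint (glue M I) F xs" for F xs y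
    using that by (auto simp: glue_def tuples_def)
  have rel: "set xs \<subseteq> verts (M k)" "length xs = rar L R"
    if "k \<in> I" "R \<in> Rels L" "xs \<in> rint (M k) R" for k R xs
    using that M L_structure_rint L_structure_length by fastforce+
  show "L_structure L (glue M I)"
    unfolding L_structure_def
  proof (intro conjI ballI subsetI)
    fix R xs assume R: "R \<in> Rels L" and xs: "xs \<in> rint (glue M I) R"
    then obtain k where "k \<in> I" "xs \<in> rint (M k) R" by (auto simp: glue_def)
    then show "xs \<in> tuples (verts (glue M I)) (rar L R)" using rel[OF _ R] by (auto simp: tuples_def)
  next
    fix F xs y assume F: "F \<in> Funs L" and "xs \<in> tuples (verts (glue M I)) (far L F)"
      "y \<in> fint (glue M I) F xs"
    then obtain k where k: "k \<in> I" "xs \<in> tuples (verts (M k)) (far L F)" "y \<in> fint (M k) F xs"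
      using cases by blast
    then have "y \<in> verts (M k)" using L_structure_fint[OF M F] by blast
    then show "y \<in> verts (glue M I)" using k by auto
  qed
  show "embedding L (M k) (glue M I) (\<lambda>v. v)" if k: "k \<in> I"
  proof (rule embeddingI[OF M[OF k]])
    show "map (\<lambda>v. v) xs \<in> rint (glue M I) R \<longleftrightarrow> xs \<in> rint (M k) R"
      if R: "R \<in> Rels L" and xs: "set xs \<subseteq> verts (M k)" for R xs
    proof
      assume "map (\<lambda>v. v) xs \<in> rint (glue M I) R"
      then obtain l where l: "l \<in> I" "xs \<in> rint (M l) R" by (auto simp: glue_def)
      then have "set xs \<subseteq> verts (M l) \<inter> verts (M k)" using rel(1)[OF l(1) R l(2)] xs by simp
      then show "xs \<in> rint (M k) R" using agree[OF l(1) k] R l(2) by (simp add: agree_on_def)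
    qed (use k in \<open>auto simp: glue_def\<close>)
  qed (use k fint_glue in auto)
  show "tuples_within L (glue M I) ((\<lambda>k. verts (M k)) ` I)"
    unfolding tuples_within_def
  proof (intro conjI ballI)
    fix R xs assume R: "R \<in> Rels L" and xs: "xs \<in> rint (glue M I) R"
    then obtain k where "k \<in> I" "xs \<in> rint (M k) R" by (auto simp: glue_def)
    then show "\<exists>S\<in>(\<lambda>k. verts (M k)) ` I. set xs \<subseteq> S" using rel[OF _ R] by auto
  next
    fix F xs y assume F: "F \<in> Funs L" and "xs \<in> tuples (verts (glue M I)) (far L F)"
      "y \<in> fint (glue M I) F xs"
    then obtain k where k: "k \<in> I" "xs \<in> tuples (verts (M k)) (far L F)" "y \<in> fint (M k) F xs"
      using cases by blast
    then have "y \<in> verts (M k)" using L_structure_fint[OF M F] by blast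
    then show "\<exists>S\<in>(\<lambda>k. verts (M k)) ` I. set (xs @ [y]) \<subseteq> S"
      using k by (auto simp: tuples_def)
  qed
qed

section \<open>Lines as embeddings into a power\<close>

context ambient_structure
begin

text \<open>The identity coordinate \<open>j0\<close> does most of the work: it separates vertices,
  reflects relations and shows that a value in the power comes from a value in \<open>P\<close>. The
  other coordinates need the function equation at non-empty values only, since an empty value at
  \<open>j0\<close> leaves no value in the power.\<close>

lemma power_embedding:
  assumes P: "partite_over P \<pi>"
    and \<sigma>: "\<And>j v. j < N \<Longrightarrow> v \<in> verts P \<Longrightarrow> \<sigma> j v \<in> verts P"
      "\<And>j v. j < N \<Longrightarrow> v \<in> verts P \<Longrightarrow> \<pi> (\<sigma> j v) = \<pi> v"
    and \<sigma>R: "\<And>j R xs. j < N \<Longrightarrow> R \<in> Rels L \<Longrightarrow> xs \<in> rint P (Inl R) \<Longrightarrow> map (\<sigma> j) xs \<in> rint P (Inl R)"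
    and \<sigma>F: "\<And>j F xs. j < N \<Longrightarrow> F \<in> Funs L \<Longrightarrow> xs \<in> tuples (verts P) (far L F) \<Longrightarrow>
      fint P F xs \<noteq> {} \<Longrightarrow> fint P F (map (\<sigma> j) xs) = \<sigma> j ` fint P F xs"
    and j0: "j0 < N" "\<And>v. v \<in> verts P \<Longrightarrow> \<sigma> j0 v = v"
  shows "(\<lambda>v\<in>verts P. \<lambda>j\<in>{..<N}. \<sigma> j v) \<in> Emb LP P (power_system D P N)"
proof -
  note p = partite_overD[OF P]
  let ?C = "power_system D P N" and ?e = "\<lambda>v\<in>verts P. \<lambda>j\<in>{..<N}. \<sigma> j v"
  have N: "0 < N" using j0 by simp
  have eC: "?e v \<in> verts ?C" if "v \<in> verts P" for v
    unfolding verts_power_system[OF P N]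
  proof (intro conjI allI impI)
    fix i assume i: "i < N"
    show "?e v i \<in> verts P" using that i \<sigma>(1) by simp
    show "\<pi> (?e v i) = \<pi> (?e v 0)" using \<sigma>(2)[OF i that] \<sigma>(2)[OF N that] i N that by simp
  qed (simp add: that)
  have coord: "map (\<lambda>x. x i) (map ?e xs) = map (\<sigma> i) xs" if "set xs \<subseteq> verts P" "i < N" for xs i
    using that by (auto simp: subset_iff)
  have id0: "map (\<sigma> j0) xs = xs" if "set xs \<subseteq> verts P" for xs
    using that j0(2) by (auto simp: subset_iff intro!: map_idI)
  have predicate: "map (\<sigma> j) xs \<in> rint P R"
    if j: "j < N" and R: "R \<in> Rels LP" and xs: "xs \<in> rint P R" for j R xs
  proof (cases R)
    case (Inl R')
    then show ?thesis using \<sigma>R[OF j, of R' xs] R xs by auto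
  next
    case (Inr d)
    then have d: "d \<in> verts D" using R by auto
    have "length xs = 1" using L_structure_length[OF p(2) R xs] Inr by simp
    then obtain v where v: "xs = [v]" by (auto simp: length_Suc_conv)
    have "v \<in> verts P" using L_structure_rint[OF p(2) R xs] v by simp
    then show ?thesis using p(5)[of v d] p(5)[of "\<sigma> j v" d] \<sigma>[OF j] d xs v Inr by simp
  qed
  have "embedding LP P ?C ?e"
  proof (rule embeddingI[OF p(2)])
    show "inj_on ?e (verts P)"
    proof (rule inj_onI)
      fix v v' assume v: "v \<in> verts P" "v' \<in> verts P" and eq: "?e v = ?e v'"
      have "?e v j0 = ?e v' j0" using eq by (rule fun_cong)
      then show "v = v'" using v j0 by simp
    qed
    show "?e ` verts P \<subseteq> verts ?C" using eC by blast
    show "map ?e xs \<in> rint ?C R \<longleftrightarrow> xs \<in> rint P R"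
      if R: "R \<in> Rels LP" and xs: "set xs \<subseteq> verts P" for R xs
    proof -
      have "set (map ?e xs) \<subseteq> verts ?C" using xs eC by auto
      then have "map ?e xs \<in> rint ?C R \<longleftrightarrow> (\<forall>i<N. map (\<sigma> i) xs \<in> rint P R)"
        unfolding power_system_simps(1) using coord[OF xs] by metis
      also have "\<dots> \<longleftrightarrow> xs \<in> rint P R"
        using predicate[OF _ R] id0[OF xs] j0(1) by metis
      finally show ?thesis .
    qed
    fix F xs assume "F \<in> Funs LP" and "xs \<in> tuples (verts P) (far LP F)"
    then have F: "F \<in> Funs L" and xs: "xs \<in> tuples (verts P) (far L F)" and xsP: "set xs \<subseteq> verts P"
      by (auto simp: tuples_def)
    have fP: "fint P F xs \<subseteq> verts P" using L_structure_fint[OF p(3) F] xs by simp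
    have fC: "y \<in> fint ?C F (map ?e xs) \<longleftrightarrow>
      y \<in> verts ?C \<and> (\<forall>i<N. y i \<in> fint P F (map (\<sigma> i) xs))" for y
      unfolding power_system_simps(2) using coord[OF xsP] by metis
    show "fint ?C F (map ?e xs) = ?e ` fint P F xs"
    proof (intro equalityI subsetI)
      fix y assume "y \<in> fint ?C F (map ?e xs)"
      then have yC: "y \<in> verts ?C" and y: "\<And>i. i < N \<Longrightarrow> y i \<in> fint P F (map (\<sigma> i) xs)"
        using fC by blast+
      let ?v = "y j0"
      have v: "?v \<in> fint P F xs" using y[OF j0(1)] id0[OF xsP] by simp
      then have vP: "?v \<in> verts P" using fP by blast
      \<comment> \<open>All coordinates of \<open>y\<close> have the same projection, and by
        \<open>inj_on_fint\<close> the projection separates the elements of one value set. So the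
        element that \<open>\<sigma> i\<close> sends to \<open>y i\<close> can only be the
        coordinate at \<open>j0\<close>.\<close>
      have yi: "y i = \<sigma> i ?v" if i: "i < N" for i
      proof -
        have "y i \<in> \<sigma> i ` fint P F xs" using y[OF i] \<sigma>F[OF i F xs] v by auto
        then obtain u where u: "u \<in> fint P F xs" "y i = \<sigma> i u" by blast
        have "\<pi> (y i) = \<pi> (y 0)" "\<pi> (y j0) = \<pi> (y 0)"
          using yC i j0(1) unfolding verts_power_system[OF P N] by blast+
        then have "\<pi> u = \<pi> ?v" using u \<sigma>(2)[OF i, of u] fP by auto
        then have "u = ?v" using inj_on_fint[OF P F xs] u v by (auto dest: inj_onD)
        then show ?thesis using u by simp
      qed
      have "y \<in> extensional {..<N}" using yC unfolding verts_power_system[OF P N] by blast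
      then have "y = ?e ?v"
        using yi vP by (intro extensionalityI[of y "{..<N}"]) auto
      then show "y \<in> ?e ` fint P F xs" using v by blast
    next
      fix y assume "y \<in> ?e ` fint P F xs"
      then obtain v where v: "v \<in> fint P F xs" "y = ?e v" by blast
      have vP: "v \<in> verts P" using v fP by blast
      have "\<sigma> i v \<in> fint P F (map (\<sigma> i) xs)" if "i < N" for i
        using \<sigma>F[OF that F xs] v(1) by auto
      then show "y \<in> fint ?C F (map ?e xs)" unfolding fC using v(2) vP eC[OF vP] by simp
    qed
  qed
  then show ?thesis by (simp add: Emb_def)
qed

definition copies_over ::
  "('a, 'r, 'f) struct \<Rightarrow> ('v, 'r + 'd, 'f) struct \<Rightarrow> ('v \<Rightarrow> 'd) \<Rightarrow> ('a \<Rightarrow> 'd) \<Rightarrow> ('a \<Rightarrow> 'v) set" where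
  "copies_over A P \<pi> \<alpha> = {g \<in> Emb L A (reduct P). \<forall>a\<in>verts A. \<pi> (g a) = \<alpha> a}"

lemma copies_overD:
  assumes "g \<in> copies_over A P \<pi> \<alpha>"
  shows "embedding L A (reduct P) g" "\<And>a. a \<in> verts A \<Longrightarrow> \<pi> (g a) = \<alpha> a" "g \<in> extensional (verts A)"
  using assms by (auto simp: copies_over_def Emb_def)

text \<open>A word in copies of A acts on the part over the image of \<alpha>: at a variable by the
  identity, at a letter by moving every vertex to the vertex of that copy with the same projection.
  Following a copy \<open>g\<close> by this map spells out the word with \<open>g\<close>
  substituted for the variable, so a monochromatic line becomes the embedding
  \<open>e\<close>.\<close>

lemma partite_ramsey:
  assumes P: "partite_over P \<pi>" and A: "L_structure L A" and \<alpha>: "embedding L A D \<alpha>" and r: "0 < r"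
  shows "\<exists>N>0. \<forall>\<chi>. (\<forall>g. \<chi> g < (r::nat)) \<longrightarrow>
    (\<exists>e\<in>Emb LP (restrict_system D P (\<alpha> ` verts A))
        (power_system D (restrict_system D P (\<alpha> ` verts A)) N).
      \<forall>g\<in>copies_over A P \<pi> \<alpha>. \<forall>g'\<in>copies_over A P \<pi> \<alpha>.
        \<chi> (compose (verts A) e g) = \<chi> (compose (verts A) e g'))"
proof -
  note p = partite_overD[OF P] and a = embeddingD[OF A \<alpha>]
  let ?S = "\<alpha> ` verts A" and ?G = "copies_over A P \<pi> \<alpha>"
  have S: "substructure L ?S D" by (rule embedding_substructure[OF A \<alpha>])
  define Q where "Q = restrict_system D P ?S"
  have Q: "partite_over Q \<pi>" unfolding Q_def by (rule partite_over_restrict_system[OF P S])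
  note q = partite_overD[OF Q]
  have Q_eq: "Q = induced P {v \<in> verts P. \<pi> v \<in> ?S}" unfolding Q_def by (rule restrict_system_eq[OF P])
  have vQ: "v \<in> verts Q \<longleftrightarrow> v \<in> verts P \<and> \<pi> v \<in> ?S" for v by (simp add: Q_eq)
  have finA: "finite (verts A)" using a(1,2) finite_D by (auto intro: inj_on_finite)
  have "finite (Emb L A (reduct P))" using p(1) by (intro finite_Emb[OF finA]) simp
  then have "finite ?G" by (rule rev_finite_subset) (auto simp: copies_over_def)
  \<comment> \<open>The alphabet is empty if no copy of A lies over \<alpha>; the Hales-Jewett
    theorem then still supplies a word, consisting of variables only.\<close>
  then obtain N where HJ: "hales_jewett_number ?G r N" using hales_jewett by blast
  define \<alpha>' where "\<alpha>' = inv_into (verts A) \<alpha>"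
  have \<alpha>': "\<alpha>' (\<pi> v) \<in> verts A" "\<alpha> (\<alpha>' (\<pi> v)) = \<pi> v" if "v \<in> verts Q" for v
    using that by (auto simp: vQ \<alpha>'_def f_inv_into_f inv_into_into)
  have \<alpha>'\<alpha>: "\<alpha>' (\<alpha> x) = x" if "x \<in> verts A" for x using a(1) that by (simp add: \<alpha>'_def)
  have g: "g x \<in> verts Q" "\<pi> (g x) = \<alpha> x" if "g \<in> ?G" "x \<in> verts A" for g x
    using copies_overD[OF that(1)] that(2) embeddingD(2)[OF A, of "reduct P" g] by (auto simp: vQ)
  define \<sigma> where "\<sigma> w v = (case w of None \<Rightarrow> v | Some g \<Rightarrow> g (\<alpha>' (\<pi> v)))" for w :: "('b \<Rightarrow> 'a) option" and v
  have \<sigma>: "\<sigma> w v \<in> verts Q" "\<pi> (\<sigma> w v) = \<pi> v"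
    if "w \<in> insert None (Some ` ?G)" "v \<in> verts Q" for w v
    using that g \<alpha>' by (auto simp: \<sigma>_def)
  have \<sigma>_None: "\<sigma> None = (\<lambda>v. v)" by (simp add: \<sigma>_def fun_eq_iff)
  have pull: "map \<alpha> (map \<alpha>' (map \<pi> xs)) = map \<pi> xs" "set (map \<alpha>' (map \<pi> xs)) \<subseteq> verts A"
    "map (\<sigma> (Some g)) xs = map g (map \<alpha>' (map \<pi> xs))"
    if "set xs \<subseteq> verts Q" for xs g
    using that \<alpha>' by (auto simp: subset_iff \<sigma>_def)
  have \<sigma>R: "map (\<sigma> w) xs \<in> rint Q (Inl R)"
    if w: "w \<in> insert None (Some ` ?G)" and R: "R \<in> Rels L" and xs: "xs \<in> rint Q (Inl R)" for w R xs
  proof (cases w)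
    case None
    then show ?thesis using xs by (simp add: \<sigma>_None)
  next
    case (Some g)
    then have gG: "g \<in> ?G" using w by auto
    have xsQ: "set xs \<subseteq> verts Q" using L_structure_rint[OF q(2), of "Inl R" xs] R xs by simp
    let ?as = "map \<alpha>' (map \<pi> xs)"
    have "map \<alpha> ?as \<in> rint D R" unfolding pull(1)[OF xsQ] by (rule q(7)[OF R xs])
    then have "?as \<in> rint A R" using a(3)[OF R pull(2)[OF xsQ]] by blast
    then have "map g ?as \<in> rint P (Inl R)"
      using embeddingD(3)[OF A copies_overD(1)[OF gG] R pull(2)[OF xsQ]] by simp
    then have "map (\<sigma> w) xs \<in> rint P (Inl R)" unfolding Some pull(3)[OF xsQ] .
    moreover have "set (map (\<sigma> w) xs) \<subseteq> verts Q" using \<sigma>(1)[OF w] xsQ by auto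
    ultimately show ?thesis by (simp add: Q_eq)
  qed
  \<comment> \<open>A non-empty value in \<open>Q\<close> projects onto the value in
    \<open>D\<close>, which \<alpha> pulls back to \<open>A\<close> and \<open>g\<close> carries
    forward. At an empty value of \<open>Q\<close> the value in \<open>D\<close> may be non-empty,
    hence the assumption \<open>ne\<close>.\<close>
  have \<sigma>F: "fint Q F (map (\<sigma> w) xs) = \<sigma> w ` fint Q F xs"
    if w: "w \<in> insert None (Some ` ?G)" and F: "F \<in> Funs L"
      and xs: "xs \<in> tuples (verts Q) (far L F)" and ne: "fint Q F xs \<noteq> {}" for w F xs
  proof (cases w)
    case None
    then show ?thesis by (simp add: \<sigma>_None)
  next
    case (Some g)
    then have gG: "g \<in> ?G" using w by auto
    have xsQ: "set xs \<subseteq> verts Q" using xs by (simp add: tuples_def)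
    let ?as = "map \<alpha>' (map \<pi> xs)"
    have as: "?as \<in> tuples (verts A) (far L F)"
      using pull(2)[OF xsQ] xs by (simp add: tuples_def)
    have fA: "fint A F ?as \<subseteq> verts A" by (rule L_structure_fint[OF A F as])
    have "\<alpha> ` fint A F ?as = fint D F (map \<pi> xs)" using a(4)[OF F as] unfolding pull(1)[OF xsQ] ..
    also have "\<dots> = \<pi> ` fint Q F xs" using q(8)[OF F xs ne] ..
    finally have eq: "\<alpha> ` fint A F ?as = \<pi> ` fint Q F xs" .
    have "fint A F ?as = \<alpha>' ` \<alpha> ` fint A F ?as"
      using inv_into_image_cancel[OF a(1) fA, symmetric] unfolding \<alpha>'_def .
    then have "fint A F ?as = \<alpha>' ` \<pi> ` fint Q F xs" unfolding eq .
    moreover have "fint Q F (map g ?as) = g ` fint A F ?as"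
      using embeddingD(4)[OF A copies_overD(1)[OF gG] F as] by (simp add: Q_eq)
    ultimately show ?thesis unfolding Some pull(3)[OF xsQ] by (simp add: image_image \<sigma>_def)
  qed
  let ?C = "power_system D Q N"
  have line: "\<exists>e\<in>Emb LP Q ?C. \<forall>g\<in>?G. \<forall>g'\<in>?G. \<chi> (compose (verts A) e g) = \<chi> (compose (verts A) e g')"
    if \<chi>: "\<forall>g. \<chi> g < r" for \<chi>
  proof -
    \<comment> \<open>A word without variables is a list of \<open>N\<close> copies of A, that is, a
      map from A into the power, and takes its colour from there.\<close>
    define \<chi>' where "\<chi>' ws = \<chi> (\<lambda>a\<in>verts A. \<lambda>j\<in>{..<N}. (ws ! j) a)" for ws :: "('b \<Rightarrow> 'a) list"
    have "\<forall>u\<in>tuples ?G N. \<chi>' u < r" using \<chi> by (simp add: \<chi>'_def)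
    then obtain w where w: "w \<in> variable_words ?G N" and mono: "monochromatic \<chi>' ?G w"
      using HJ unfolding hales_jewett_number_def by blast
    have len: "length w = N" and wj: "\<And>j. j < N \<Longrightarrow> w ! j \<in> insert None (Some ` ?G)"
      using w nth_mem unfolding variable_words_def by blast+
    obtain j0 where j0: "j0 < N" "w ! j0 = None"
      using w by (auto simp: variable_words_def in_set_conv_nth)
    let ?e = "\<lambda>v\<in>verts Q. \<lambda>j\<in>{..<N}. \<sigma> (w ! j) v"
    have e: "?e \<in> Emb LP Q ?C"
      by (rule power_embedding[OF Q, of N "\<lambda>j. \<sigma> (w ! j)" j0])
        (use wj \<sigma> \<sigma>R \<sigma>F j0 in \<open>auto simp: \<sigma>_def\<close>)
    have "\<chi> (compose (verts A) ?e g) = \<chi>' (subst_word g w)" if gG: "g \<in> ?G" for g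
    proof -
      have "compose (verts A) ?e g = (\<lambda>a\<in>verts A. \<lambda>j\<in>{..<N}. (subst_word g w ! j) a)"
        unfolding compose_def
      proof (rule restrict_ext)
        fix x assume x: "x \<in> verts A"
        have "?e (g x) = (\<lambda>j\<in>{..<N}. \<sigma> (w ! j) (g x))" using g(1)[OF gG x] by simp
        also have "\<dots> = (\<lambda>j\<in>{..<N}. (subst_word g w ! j) x)"
        proof (rule restrict_ext)
          fix j assume j: "j \<in> {..<N}"
          show "\<sigma> (w ! j) (g x) = (subst_word g w ! j) x"
            using j len g(2)[OF gG x] \<alpha>'\<alpha>[OF x]
            by (cases "w ! j") (auto simp: subst_word_def \<sigma>_def)
        qed
        finally show "?e (g x) = (\<lambda>j\<in>{..<N}. (subst_word g w ! j) x)" .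
      qed
      then show ?thesis by (simp add: \<chi>'_def)
    qed
    then show ?thesis using e mono unfolding monochromatic_def by metis
  qed
  have "0 < N" by (rule hales_jewett_number_pos[OF HJ r])
  then show ?thesis using line unfolding Q_def by blast
qed

end

section \<open>The initial system and the free extension\<close>

text \<open>Powers and disjoint sums leave the vertex type. Recoding finite vertex sets by natural
  numbers keeps all systems of the sequence in one type.\<close>

lemma finite_inj_to_nat:
  assumes "finite X"
  obtains enc :: "'x \<Rightarrow> nat" where "inj_on enc X"
  using finite_imp_inj_to_nat_seg[OF assms] by blast

context ambient_structure
begin

text \<open>Vertices are codes of pairs of an index \<open>k\<close> of an embedding of
  \<open>B\<close> into \<open>D\<close> and a vertex of \<open>B\<close>; the projection decodes
  the pair and applies the embedding. Taking all embeddings provides a copy over whichever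
  \<open>b\<close> the arrow for \<open>D\<close> will select.\<close>

lemma initial_system:
  assumes lang: "language L" and B: "L_structure L B" and ne: "Emb L B D \<noteq> {}"
    and \<B>: "\<And>b. b \<in> Emb L B D \<Longrightarrow> b ` verts B \<in> \<B>"
  obtains P :: "(nat, 'r + 'd, 'f) struct" and \<pi> where "partite_over P \<pi>"
    "disjoint_union_of_copies L B (reduct P)"
    "\<And>b. b \<in> Emb L B D \<Longrightarrow> \<exists>f. embedding L B (reduct P) f \<and> (\<forall>v\<in>verts B. \<pi> (f v) = b v)"
proof -
  obtain b0 where "embedding L B D b0" using ne by (auto simp: Emb_def)
  note b0 = embeddingD[OF B this]
  have finB: "finite (verts B)" using b0(1,2) finite_D by (auto intro: inj_on_finite)
  have finE: "finite (Emb L B D)" by (rule finite_Emb[OF finB finite_D])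
  define n where "n = card (Emb L B D)"
  have n: "0 < n" using finE ne by (simp add: n_def card_gt_0_iff)
  obtain h where "bij_betw h {0..<n} (Emb L B D)"
    using ex_bij_betw_nat_finite[OF finE] by (auto simp: n_def)
  then have hE: "h ` {..<n} = Emb L B D" by (simp add: bij_betw_def lessThan_atLeast0)
  have h: "h k \<in> Emb L B D" if "k < n" for k using that hE by blast
  have "finite ({..<n} \<times> verts B)" using finB by simp
  then obtain enc :: "nat \<times> 'a \<Rightarrow> nat" where enc: "inj_on enc ({..<n} \<times> verts B)"
    by (rule finite_inj_to_nat)
  define f where "f k v = enc (k, v)" for k v
  have f_eq: "k = l \<and> v = u" if "f k v = f l u" "k < n" "l < n" "v \<in> verts B" "u \<in> verts B" for k l v u
    using inj_onD[OF enc, of "(k, v)" "(l, u)"] that by (simp add: f_def)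
  define X where "X k = expansion B (h k)" for k
  have X: "partite_over (X k) (h k)" if "k < n" for k
    unfolding X_def using h[OF that] \<B> by (intro partite_over_expansion[OF B]) (auto simp: Emb_def)
  have vX: "verts (X k) = verts B" for k by (simp add: X_def)
  have injf: "inj_on (f k) (verts (X k))" if "k < n" for k
    using f_eq that by (auto simp: inj_on_def vX)
  define M where "M k = image_struct (f k) (X k)" for k
  have vM: "verts (M k) = f k ` verts B" for k by (simp add: M_def vX)
  define P where "P = glue M {..<n}"
  have M: "L_structure LP (M k)" if "k \<in> {..<n}" for k
    unfolding M_def using that by (intro L_structure_image_struct partite_overD(2)[OF X] injf) auto
  have disj: "verts (M k) \<inter> verts (M l) = {}" if "k < n" "l < n" "k \<noteq> l" for k l
    using f_eq that by (fastforce simp: vM)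
  have agree: "agree_on LP (M k) (M l) (verts (M k) \<inter> verts (M l))"
    if kl: "k \<in> {..<n}" "l \<in> {..<n}" for k l
  proof (cases "k = l")
    case True
    then show ?thesis by (simp add: agree_on_def)
  next
    case False
    \<comment> \<open>Disjoint copies share only the empty tuple. Nullary relations come from
      \<open>B\<close> and hold in all copies alike, and nullary functions are excluded by
      \<open>language\<close>.\<close>
    have nil: "[] \<in> rint (M k) R \<longleftrightarrow> [] \<in> rint (X k) R" for k R
      by (auto simp: M_def image_struct_def)
    have "[] \<in> rint (M k) R \<longleftrightarrow> [] \<in> rint (M l) R" for R
      unfolding nil by (cases R) (auto simp: X_def)
    moreover have "tuples {} (far L F) = {}" if "F \<in> Funs L" for F
      using lang that by (auto simp: language_def tuples_def)
    ultimately show ?thesis using disj[of k l] kl False by (auto simp: agree_on_def)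
  qed
  note G = glue[of "{..<n}" LP M, OF M agree, folded P_def]
  have emb: "embedding LP (X k) P (f k)" if k: "k < n" for k
  proof -
    have "embedding LP (X k) (M k) (f k)"
      unfolding M_def by (rule embedding_image_struct[OF partite_overD(2)[OF X[OF k]] injf[OF k]])
    from embedding_comp[OF partite_overD(2)[OF X[OF k]] M this G(2)] k show ?thesis by simp
  qed
  define \<pi> where "\<pi> u = (case inv_into ({..<n} \<times> verts B) enc u of (k, v) \<Rightarrow> h k v)" for u
  have \<pi>: "\<pi> (f k v) = h k v" if "k < n" "v \<in> verts B" for k v
    using inv_into_f_f[OF enc, of "(k, v)"] that by (simp add: \<pi>_def f_def)
  have sub: "substructure LP (f k ` verts B) P" if "k < n" for k
    using embedding_substructure[OF partite_overD(2)[OF X] emb] that by (simp add: vX)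
  have vP: "verts P = (\<Union>k<n. f k ` verts B)" by (simp add: P_def vM)
  have within: "tuples_within LP P ((\<lambda>k. f k ` verts B) ` {..<n})" using G(3) by (simp add: vM)
  \<comment> \<open>The copies are disjoint, so the core is empty; it is a substructure because
    function symbols have positive arity.\<close>
  have "partite_over P \<pi>"
  proof (rule partite_over_union[OF G(1) _ within, where K = "{}"])
    show "finite (verts P)" using finB by (simp add: vP)
    show "verts P = \<Union>((\<lambda>k. f k ` verts B) ` {..<n})" by (simp add: vP)
    fix S assume "S \<in> (\<lambda>k. f k ` verts B) ` {..<n}"
    then obtain k where k: "k < n" "S = f k ` verts B" by auto
    show "substructure LP S P" using sub k by simp
    show "partite_over (induced P S) \<pi>"
      using partite_over_image[OF X[OF k(1)] emb[OF k(1)], of \<pi>] \<pi>[OF k(1)] k(2) by (simp add: vX)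
  next
    show "substructure LP {} P" using lang by (auto simp: substructure_def tuples_def language_def)
    show "\<exists>S\<in>(\<lambda>k. f k ` verts B) ` {..<n}. {} \<subseteq> S" using n by auto
    show "S \<inter> S' \<subseteq> {}"
      if "S \<in> (\<lambda>k. f k ` verts B) ` {..<n}" "S' \<in> (\<lambda>k. f k ` verts B) ` {..<n}" "S \<noteq> S'" for S S'
      using that disj unfolding vM by fastforce
  qed
  moreover have embL: "embedding L B (reduct P) (f k)" if "k < n" for k
    using embedding_reduct[OF partite_overD(2)[OF X] emb] that by (simp add: X_def)
  have "disjoint_union_of_copies L B (reduct P)"
    unfolding disjoint_union_of_copies_def
  proof (intro exI conjI allI impI)
    show "0 < n" by (rule n)
    show "embedding L B (reduct P) (f k)" if "k < n" for k by (rule embL[OF that])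
    show "f k ` verts B \<inter> f l ` verts B = {}" if "k < n" "l < n" "k \<noteq> l" for k l
      using disj[OF that] by (simp add: vM)
    show "verts (reduct P) = (\<Union>k<n. f k ` verts B)" by (simp add: vP)
    show "tuples_within L (reduct P) ((\<lambda>k. f k ` verts B) ` {..<n})"
      using within by (simp add: tuples_within_def ball_Un)
  qed
  moreover have "\<exists>f. embedding L B (reduct P) f \<and> (\<forall>v\<in>verts B. \<pi> (f v) = b v)"
    if b: "b \<in> Emb L B D" for b
  proof -
    obtain k where "k < n" "b = h k" using b hE by blast
    then show ?thesis using embL[of k] \<pi>[of k] by blast
  qed
  ultimately show ?thesis by (rule that)
qed

text \<open>The power contains all intersections of different copies of \<open>P\<close>, so it can
  be the core in \<open>partite_over_union\<close>: an irreducible substructure of the extension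
  lies in the power or in a single copy.\<close>

lemma free_extension:
  fixes P :: "(nat, 'r + 'd, 'f) struct"
  assumes P: "partite_over P \<pi>" and S: "substructure L S D" and N: "0 < N"
  defines "PS \<equiv> restrict_system D P S"
  defines "C \<equiv> power_system D PS N"
  defines "\<E> \<equiv> Emb LP PS C"
  obtains Q :: "(nat, 'r + 'd, 'f) struct" and \<pi>' \<iota> \<phi> where
    "partite_over Q \<pi>'"
    "embedding LP C Q \<iota>"
    "\<And>e. e \<in> \<E> \<Longrightarrow> embedding LP P Q (\<phi> e)"
    "\<And>e v. e \<in> \<E> \<Longrightarrow> v \<in> verts PS \<Longrightarrow> \<phi> e v = \<iota> (e v)"
    "\<And>e. e \<in> \<E> \<Longrightarrow> \<phi> e ` verts P \<inter> \<iota> ` verts C = \<iota> ` e ` verts PS"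
    "\<And>e e'. e \<in> \<E> \<Longrightarrow> e' \<in> \<E> \<Longrightarrow> e \<noteq> e' \<Longrightarrow> \<phi> e ` verts P \<inter> \<phi> e' ` verts P \<subseteq> \<iota> ` verts C"
    "verts Q = \<iota> ` verts C \<union> (\<Union>e\<in>\<E>. \<phi> e ` verts P)"
    "tuples_within LP Q (insert (\<iota> ` verts C) ((\<lambda>e. \<phi> e ` verts P) ` \<E>))"
proof -
  note p = partite_overD[OF P]
  have PS: "partite_over PS \<pi>" unfolding PS_def by (rule partite_over_restrict_system[OF P S])
  have C: "partite_over C (\<lambda>x. \<pi> (x 0))" unfolding C_def by (rule partite_over_power_system[OF PS N])
  note ps = partite_overD[OF PS] and c = partite_overD[OF C]
  have PS_eq: "PS = induced P {v \<in> verts P. \<pi> v \<in> S}"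
    unfolding PS_def by (rule restrict_system_eq[OF P])
  have PSP: "verts PS \<subseteq> verts P" by (auto simp: PS_eq)
  have incl: "embedding LP PS P (\<lambda>v. v)"
    unfolding PS_eq using substructure_preimage[OF P S]
    by (intro embedding_inclusion[OF p(2)]) (simp add: substructure_reduct)
  have finE: "finite \<E>" unfolding \<E>_def by (rule finite_Emb[OF ps(1) c(1)])
  have e: "embedding LP PS C e" if "e \<in> \<E>" for e using that by (simp add: \<E>_def Emb_def)
  note eD = embeddingD[OF ps(2) e]
  have eC: "e v \<in> verts C" if "e \<in> \<E>" "v \<in> verts PS" for e v using eD(2)[OF that(1)] that(2) by blast
  have "finite (verts C <+> \<E> \<times> verts P)" using c(1) finE p(1) by simp
  then obtain enc :: "(nat \<Rightarrow> nat) + (nat \<Rightarrow> nat \<Rightarrow> nat) \<times> nat \<Rightarrow> nat"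
    where enc: "inj_on enc (verts C <+> \<E> \<times> verts P)" by (rule finite_inj_to_nat)
  define \<iota> where "\<iota> x = enc (Inl x)" for x
  \<comment> \<open>Over \<open>S\<close> a copy of \<open>P\<close> is attached along
    \<open>e\<close>; its remaining vertices are marked by \<open>e\<close>, which keeps different
    copies disjoint outside the power.\<close>
  define \<phi> where "\<phi> e v = (if v \<in> verts PS then \<iota> (e v) else enc (Inr (e, v)))" for e v
  have \<iota>_eq: "x = y" if "\<iota> x = \<iota> y" "x \<in> verts C" "y \<in> verts C" for x y
    using inj_onD[OF enc, of "Inl x" "Inl y"] that by (simp add: \<iota>_def InlI)
  have new_eq: "e = e' \<and> v = v'"
    if "enc (Inr (e, v)) = enc (Inr (e', v'))" "e \<in> \<E>" "e' \<in> \<E>" "v \<in> verts P" "v' \<in> verts P" for e e' v v'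
    using inj_onD[OF enc, of "Inr (e, v)" "Inr (e', v')"] that by (simp add: InrI)
  have \<iota>_new: "\<iota> x \<noteq> enc (Inr (e, v))" if "x \<in> verts C" "e \<in> \<E>" "v \<in> verts P" for x e v
    using inj_onD[OF enc, of "Inl x" "Inr (e, v)"] that by (auto simp: \<iota>_def InlI InrI)
  have \<iota>: "inj_on \<iota> (verts C)" using \<iota>_eq by (auto intro: inj_onI)
  have \<phi>: "inj_on (\<phi> e) (verts P)" if E: "e \<in> \<E>" for e
  proof (rule inj_onI)
    fix u v assume uv: "u \<in> verts P" "v \<in> verts P" "\<phi> e u = \<phi> e v"
    show "u = v"
    proof (cases "u \<in> verts PS")
      case True
      note u = True
      show ?thesis
      proof (cases "v \<in> verts PS")
        case True
        then have "e u = e v" using uv u \<iota>_eq eC[OF E] by (simp add: \<phi>_def)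
        then show ?thesis using eD(1)[OF E] u True by (auto dest: inj_onD)
      next
        case False
        then show ?thesis using uv u \<iota>_new[OF eC[OF E u] E] by (simp add: \<phi>_def)
      qed
    next
      case False
      note u = False
      show ?thesis
      proof (cases "v \<in> verts PS")
        case True
        then show ?thesis using uv u \<iota>_new[OF eC[OF E True] E uv(1)] by (simp add: \<phi>_def)
      next
        case False
        then show ?thesis using uv u new_eq[of e u e v] E by (simp add: \<phi>_def)
      qed
    qed
  qed
  have \<phi>PS: "\<phi> e v = \<iota> (e v)" if "v \<in> verts PS" for e v using that by (simp add: \<phi>_def)
  have int1: "\<phi> e ` verts P \<inter> \<iota> ` verts C = \<iota> ` e ` verts PS" if E: "e \<in> \<E>" for e
  proof (intro equalityI subsetI)
    fix u assume "u \<in> \<phi> e ` verts P \<inter> \<iota> ` verts C"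
    then obtain v x where v: "v \<in> verts P" "u = \<phi> e v" and x: "x \<in> verts C" "u = \<iota> x" by blast
    have "v \<in> verts PS" using v x \<iota>_new[OF x(1) E v(1)] by (auto simp: \<phi>_def split: if_splits)
    then show "u \<in> \<iota> ` e ` verts PS" using v \<phi>PS by auto
  next
    fix u assume "u \<in> \<iota> ` e ` verts PS"
    then obtain v where v: "v \<in> verts PS" "u = \<iota> (e v)" by blast
    have "u = \<phi> e v" using v \<phi>PS by simp
    then show "u \<in> \<phi> e ` verts P \<inter> \<iota> ` verts C" using v PSP eC[OF E v(1)] by blast
  qed
  have int2: "\<phi> e ` verts P \<inter> \<phi> e' ` verts P \<subseteq> \<iota> ` verts C"
    if E: "e \<in> \<E>" "e' \<in> \<E>" "e \<noteq> e'" for e e'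
  proof
    fix u assume "u \<in> \<phi> e ` verts P \<inter> \<phi> e' ` verts P"
    then obtain v v' where v: "v \<in> verts P" "u = \<phi> e v" and v': "v' \<in> verts P" "u = \<phi> e' v'" by blast
    have "v \<in> verts PS \<or> v' \<in> verts PS"
      using v v' new_eq[of e v e' v'] E by (auto simp: \<phi>_def)
    then show "u \<in> \<iota> ` verts C" using v v' \<phi>PS eC E by (metis imageI)
  qed
  define M where "M k = (case k of None \<Rightarrow> image_struct \<iota> C | Some e \<Rightarrow> image_struct (\<phi> e) P)" for k
  define I where "I = insert None (Some ` \<E>)"
  define Q where "Q = glue M I"
  have MN: "M None = image_struct \<iota> C" and MS: "\<And>e. M (Some e) = image_struct (\<phi> e) P"
    by (simp_all add: M_def)
  have eN: "embedding LP C (M None) \<iota>" unfolding MN by (rule embedding_image_struct[OF c(2) \<iota>])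
  have eS: "embedding LP P (M (Some e)) (\<phi> e)" if "e \<in> \<E>" for e
    unfolding MS by (rule embedding_image_struct[OF p(2) \<phi>[OF that]])
  have M: "L_structure LP (M k)" if "k \<in> I" for k
    using that L_structure_image_struct[OF c(2) \<iota>] L_structure_image_struct[OF p(2) \<phi>]
    by (auto simp: I_def M_def)
  \<comment> \<open>Both structures receive \<open>PS\<close> along the same map: the power by
    \<open>\<iota>\<close> after \<open>e\<close>, the copy by the restriction of
    \<open>\<phi> e\<close>.\<close>
  have agree1: "agree_on LP (M None) (M (Some e)) (\<iota> ` e ` verts PS)" if E: "e \<in> \<E>" for e
  proof -
    have "embedding LP PS (M None) (\<lambda>v. \<iota> (e v))" by (rule embedding_comp[OF ps(2) c(2) e[OF E] eN])
    moreover have "embedding LP PS (M (Some e)) (\<lambda>v. \<iota> (e v))"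
      using embedding_comp[OF ps(2) p(2) incl eS[OF E]]
      by (subst embedding_cong[OF ps(2), of _ "\<phi> e"]) (simp_all add: \<phi>PS)
    ultimately show ?thesis using agree_on_embedding[OF ps(2)] by (metis image_image)
  qed
  have agree: "agree_on LP (M k) (M l) (verts (M k) \<inter> verts (M l))" if kl: "k \<in> I" "l \<in> I" for k l
  proof (cases "k = l")
    case True
    then show ?thesis by (simp add: agree_on_def)
  next
    case False
    have NS: "agree_on LP (M None) (M (Some e)) (\<phi> e ` verts P \<inter> \<iota> ` verts C)" if "e \<in> \<E>" for e
      unfolding int1[OF that] by (rule agree1[OF that])
    consider e where "k = None" "l = Some e" "e \<in> \<E>" | e where "k = Some e" "l = None" "e \<in> \<E>"
      | e e' where "k = Some e" "l = Some e'" "e \<in> \<E>" "e' \<in> \<E>" "e \<noteq> e'"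
      using kl False by (auto simp: I_def)
    then show ?thesis
    proof cases
      case 1
      then show ?thesis using NS by (simp add: MN MS Int_commute)
    next
      case 2
      then show ?thesis using agree_on_sym[OF NS] by (simp add: MN MS)
    next
      case 3
      \<comment> \<open>Two copies meet inside the power only, and each of them agrees with the
        power there.\<close>
      let ?W = "\<phi> e ` verts P \<inter> \<phi> e' ` verts P"
      have "agree_on LP (M None) (M (Some e)) ?W" "agree_on LP (M None) (M (Some e')) ?W"
        using agree_on_subset[OF NS, of _ ?W] int2 3 by blast+
      then show ?thesis using 3 agree_on_sym agree_on_trans by (simp add: MS) blast
    qed
  qed
  note G = glue[of I LP M, OF M agree, folded Q_def]
  have embC: "embedding LP C Q \<iota>"
    using embedding_comp[OF c(2) M eN G(2)] by (simp add: I_def)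
  have embP: "embedding LP P Q (\<phi> e)" if E: "e \<in> \<E>" for e
    using embedding_comp[OF p(2) M eS[OF E] G(2)] E by (simp add: I_def)
  have vQ: "verts Q = \<iota> ` verts C \<union> (\<Union>e\<in>\<E>. \<phi> e ` verts P)"
    by (simp add: Q_def I_def MN MS)
  let ?S = "insert (\<iota> ` verts C) ((\<lambda>e. \<phi> e ` verts P) ` \<E>)"
  have within: "tuples_within LP Q ?S" using G(3) by (simp add: I_def MN MS image_image)
  define \<pi>' where "\<pi>' u = (case inv_into (verts C <+> \<E> \<times> verts P) enc u of
    Inl x \<Rightarrow> \<pi> (x 0) | Inr (e, v) \<Rightarrow> \<pi> v)" for u
  have \<pi>'C: "\<pi>' (\<iota> x) = \<pi> (x 0)" if "x \<in> verts C" for x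
    using inv_into_f_f[OF enc, of "Inl x"] that by (simp add: \<pi>'_def \<iota>_def InlI)
  \<comment> \<open>The code of a vertex over \<open>S\<close> refers to the power and not to the
    copy; its projection is the same because \<open>e\<close> preserves predicates.\<close>
  have \<pi>'P: "\<pi>' (\<phi> e v) = \<pi> v" if E: "e \<in> \<E>" and v: "v \<in> verts P" for e v
  proof (cases "v \<in> verts PS")
    case True
    then show ?thesis
      using \<pi>'C[OF eC[OF E True]] embedding_projection[OF PS C e[OF E] True] by (simp add: \<phi>PS)
  next
    case False
    then show ?thesis using inv_into_f_f[OF enc, of "Inr (e, v)"] E v by (simp add: \<pi>'_def \<phi>_def InrI)
  qed
  have "partite_over Q \<pi>'"
  proof (rule partite_over_union[OF G(1) _ within, where K = "\<iota> ` verts C"])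
    show "finite (verts Q)" using c(1) p(1) finE by (simp add: vQ)
    show "verts Q = \<Union>?S" by (auto simp: vQ)
    show subC: "substructure LP (\<iota> ` verts C) Q" by (rule embedding_substructure[OF c(2) embC])
    show "substructure LP T Q" if "T \<in> ?S" for T
      using that subC embedding_substructure[OF p(2) embP] by auto
    show "partite_over (induced Q T) \<pi>'" if "T \<in> ?S" for T
      using that partite_over_image[OF C embC, of \<pi>'] partite_over_image[OF P embP, of _ \<pi>'] \<pi>'C \<pi>'P
      by auto
    show "\<exists>T\<in>?S. \<iota> ` verts C \<subseteq> T" by blast
    show "T \<inter> T' \<subseteq> \<iota> ` verts C" if T: "T \<in> ?S" "T' \<in> ?S" "T \<noteq> T'" for T T'
    proof (cases "T = \<iota> ` verts C \<or> T' = \<iota> ` verts C")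
      case False
      then obtain e e' where e: "e \<in> \<E>" "T = \<phi> e ` verts P" "e' \<in> \<E>" "T' = \<phi> e' ` verts P"
        using T by auto
      then show ?thesis using int2[of e e'] T(3) by auto
    qed auto
  qed
  from that[OF this embC embP \<phi>PS int1 int2 vQ within] show ?thesis by blast
qed

end

section \<open>The partite construction\<close>

context ambient_structure
begin

text \<open>Since projections are preserved, homogeneity obtained in a later system applies to the
  images of copies from an earlier one.\<close>

lemma compose_copies_over:
  assumes P: "partite_over P \<pi>" and Q: "partite_over Q \<pi>'" and A: "L_structure L A"
    and f: "embedding LP P Q f" and g: "g \<in> copies_over A P \<pi> \<alpha>"
  shows "compose (verts A) f g \<in> copies_over A Q \<pi>' \<alpha>"
proof -
  note p = partite_overD[OF P] and gD = copies_overD[OF g]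
  have "embedding L A (reduct Q) (compose (verts A) f g)"
    by (rule embedding_compose[OF A p(3) gD(1) embedding_reduct[OF p(2) f]])
  moreover have "\<pi>' (compose (verts A) f g a) = \<alpha> a" if "a \<in> verts A" for a
  proof -
    have "g a \<in> verts P" using embeddingD(2)[OF A gD(1)] that by auto
    then show ?thesis
      using embedding_projection[OF P Q f] gD(2)[OF that] that by (simp add: compose_eq)
  qed
  ultimately show ?thesis by (simp add: copies_over_def Emb_def compose_def)
qed

lemma partite_step:
  fixes P :: "(nat, 'r + 'd, 'f) struct"
  assumes P: "partite_over P \<pi>" and A: "L_structure L A" and \<alpha>: "embedding L A D \<alpha>" and r: "0 < r"
  obtains Q :: "(nat, 'r + 'd, 'f) struct" and \<pi>' where "partite_over Q \<pi>'"
    "based L D P (\<alpha> ` verts A) Q"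
    "\<forall>\<chi>. (\<forall>g. \<chi> g < (r::nat)) \<longrightarrow> (\<exists>f. embedding LP P Q f \<and>
      (\<forall>g\<in>copies_over A P \<pi> \<alpha>. \<forall>g'\<in>copies_over A P \<pi> \<alpha>.
        \<chi> (compose (verts A) f g) = \<chi> (compose (verts A) f g')))"
proof -
  let ?S = "\<alpha> ` verts A" and ?G = "copies_over A P \<pi> \<alpha>"
  let ?PS = "restrict_system D P ?S"
  have S: "substructure L ?S D" by (rule embedding_substructure[OF A \<alpha>])
  obtain N where N: "0 < N" and ramsey: "\<And>\<chi>. (\<forall>g. \<chi> g < r) \<Longrightarrow>
    \<exists>e\<in>Emb LP ?PS (power_system D ?PS N). \<forall>g\<in>?G. \<forall>g'\<in>?G.
      \<chi> (compose (verts A) e g) = \<chi> (compose (verts A) e g')"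
    using partite_ramsey[OF P A \<alpha> r] by blast
  let ?C = "power_system D ?PS N"
  obtain Q :: "(nat, 'r + 'd, 'f) struct" and \<pi>' \<iota> \<phi> where
    Q: "partite_over Q \<pi>'" and \<iota>: "embedding LP ?C Q \<iota>"
    and \<phi>: "\<And>e. e \<in> Emb LP ?PS ?C \<Longrightarrow> embedding LP P Q (\<phi> e)"
    and ext: "\<And>e v. e \<in> Emb LP ?PS ?C \<Longrightarrow> v \<in> verts ?PS \<Longrightarrow> \<phi> e v = \<iota> (e v)"
    and free: "\<And>e. e \<in> Emb LP ?PS ?C \<Longrightarrow> \<phi> e ` verts P \<inter> \<iota> ` verts ?C = \<iota> ` e ` verts ?PS"
      "\<And>e e'. e \<in> Emb LP ?PS ?C \<Longrightarrow> e' \<in> Emb LP ?PS ?C \<Longrightarrow> e \<noteq> e' \<Longrightarrow>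
        \<phi> e ` verts P \<inter> \<phi> e' ` verts P \<subseteq> \<iota> ` verts ?C"
      "verts Q = \<iota> ` verts ?C \<union> (\<Union>e\<in>Emb LP ?PS ?C. \<phi> e ` verts P)"
      "tuples_within LP Q (insert (\<iota> ` verts ?C) ((\<lambda>e. \<phi> e ` verts P) ` Emb LP ?PS ?C))"
    by (rule free_extension[OF P S N]) (rule that)
  have "based L D P ?S Q"
    unfolding based_def Let_def
  proof (rule exI[of _ N], intro conjI exI[of _ \<iota>] exI[of _ \<phi>] ballI impI)
    fix e assume e: "e \<in> Emb LP ?PS ?C"
    show "embedding LP P Q (\<phi> e)" by (rule \<phi>[OF e])
    show "\<phi> e v = \<iota> (e v)" if "v \<in> verts ?PS" for v by (rule ext[OF e that])
    show "\<phi> e ` verts P \<inter> \<iota> ` verts ?C = \<iota> ` e ` verts ?PS" by (rule free(1)[OF e])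
    show "\<phi> e ` verts P \<inter> \<phi> e' ` verts P \<subseteq> \<iota> ` verts ?C" if "e' \<in> Emb LP ?PS ?C" "e \<noteq> e'" for e'
      by (rule free(2)[OF e that])
  qed (fact N \<iota> free(3,4))+
  moreover have "\<exists>f. embedding LP P Q f \<and> (\<forall>g\<in>?G. \<forall>g'\<in>?G.
      \<chi> (compose (verts A) f g) = \<chi> (compose (verts A) f g'))" if \<chi>: "\<forall>g. \<chi> g < r" for \<chi>
  proof -
    \<comment> \<open>Copies of A in the power are coloured through \<open>\<iota>\<close>, as
      copies in \<open>Q\<close>.\<close>
    obtain e where e: "e \<in> Emb LP ?PS ?C" and mono: "\<And>g g'. g \<in> ?G \<Longrightarrow> g' \<in> ?G \<Longrightarrow>
      \<chi> (compose (verts A) \<iota> (compose (verts A) e g)) = \<chi> (compose (verts A) \<iota> (compose (verts A) e g'))"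
      using ramsey[of "\<lambda>g. \<chi> (compose (verts A) \<iota> g)"] \<chi> by blast
    \<comment> \<open>A copy over \<alpha> lies entirely in the restricted part, where
      \<open>\<phi> e\<close> is \<open>\<iota>\<close> after \<open>e\<close>.\<close>
    have "compose (verts A) (\<phi> e) g = compose (verts A) \<iota> (compose (verts A) e g)" if g: "g \<in> ?G" for g
      unfolding compose_def
    proof (rule restrict_ext)
      fix a assume a: "a \<in> verts A"
      have "g a \<in> verts P" "\<pi> (g a) = \<alpha> a"
        using copies_overD[OF g] embeddingD(2)[OF A copies_overD(1)[OF g]] a by auto
      then have "g a \<in> verts ?PS" using a by (simp add: restrict_system_eq[OF P])
      then show "\<phi> e (g a) = \<iota> ((\<lambda>x\<in>verts A. e (g x)) a)" using ext[OF e] a by simp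
    qed
    then show ?thesis using \<phi>[OF e] mono by metis
  qed
  ultimately show ?thesis using that[OF Q] by blast
qed

text \<open>Induction on the list with the first system arbitrary. The embedding for the tail is
  chosen first, and the head is then treated for the colouring pulled back along it. Colourings are
  total and bounded everywhere, so pulling back requires no bookkeeping of domains.\<close>

lemma partite_construction:
  fixes P :: "(nat, 'r + 'd, 'f) struct"
  assumes A: "L_structure L A" and r: "0 < r"
  shows "partite_over P \<pi> \<Longrightarrow> (\<And>\<alpha>. \<alpha> \<in> set \<alpha>s \<Longrightarrow> embedding L A D \<alpha>) \<Longrightarrow>
    \<exists>(Ps :: nat \<Rightarrow> (nat, 'r + 'd, 'f) struct). Ps 0 = P \<and>
      (\<forall>i\<le>length \<alpha>s. \<exists>\<pi>. partite_over (Ps i) \<pi>) \<and>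
      (\<forall>i<length \<alpha>s. based L D (Ps i) (\<alpha>s ! i ` verts A) (Ps (Suc i))) \<and>
      (\<forall>\<chi>. (\<forall>g. \<chi> g < (r::nat)) \<longrightarrow> (\<exists>f. embedding LP P (Ps (length \<alpha>s)) f \<and>
        (\<forall>\<alpha>\<in>set \<alpha>s. \<forall>g\<in>copies_over A P \<pi> \<alpha>. \<forall>g'\<in>copies_over A P \<pi> \<alpha>.
          \<chi> (compose (verts A) f g) = \<chi> (compose (verts A) f g'))))"
proof (induction \<alpha>s arbitrary: P \<pi>)
  case Nil
  have "embedding LP P P (\<lambda>v. v)"
    by (rule embeddingI[OF partite_overD(2)[OF Nil(1)]]) auto
  then show ?case using Nil(1) by (intro exI[of _ "\<lambda>_. P"]) auto
next
  case (Cons \<alpha> \<alpha>s)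
  note P = \<open>partite_over P \<pi>\<close>
  have \<alpha>: "embedding L A D \<alpha>" using Cons.prems(2) by simp
  obtain Q :: "(nat, 'r + 'd, 'f) struct" and \<pi>' where
    Q: "partite_over Q \<pi>'" and based: "based L D P (\<alpha> ` verts A) Q"
    and step: "\<forall>\<chi>. (\<forall>g. \<chi> g < r) \<longrightarrow> (\<exists>f. embedding LP P Q f \<and>
      (\<forall>g\<in>copies_over A P \<pi> \<alpha>. \<forall>g'\<in>copies_over A P \<pi> \<alpha>.
        \<chi> (compose (verts A) f g) = \<chi> (compose (verts A) f g')))"
    by (rule partite_step[OF P A \<alpha> r])
  have "\<And>\<beta>. \<beta> \<in> set \<alpha>s \<Longrightarrow> embedding L A D \<beta>" using Cons.prems(2) by simp
  from Cons.IH[OF Q this] obtain Ps :: "nat \<Rightarrow> (nat, 'r + 'd, 'f) struct" where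
    Ps0: "Ps 0 = Q" and Ps: "\<And>i. i \<le> length \<alpha>s \<Longrightarrow> \<exists>\<pi>. partite_over (Ps i) \<pi>"
    "\<And>i. i < length \<alpha>s \<Longrightarrow> based L D (Ps i) (\<alpha>s ! i ` verts A) (Ps (Suc i))"
    and IH: "\<And>\<chi>. (\<forall>g. \<chi> g < r) \<Longrightarrow> \<exists>f. embedding LP Q (Ps (length \<alpha>s)) f \<and>
        (\<forall>\<beta>\<in>set \<alpha>s. \<forall>g\<in>copies_over A Q \<pi>' \<beta>. \<forall>g'\<in>copies_over A Q \<pi>' \<beta>.
          \<chi> (compose (verts A) f g) = \<chi> (compose (verts A) f g'))"
    by blast
  let ?Ps = "case_nat P Ps"
  show ?case
  proof (intro exI[of _ ?Ps] conjI allI impI)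
    show "?Ps 0 = P" by simp
    show "\<exists>\<pi>. partite_over (?Ps i) \<pi>" if "i \<le> length (\<alpha> # \<alpha>s)" for i
      using that P Ps(1) by (cases i) auto
    show "based L D (?Ps i) ((\<alpha> # \<alpha>s) ! i ` verts A) (?Ps (Suc i))" if "i < length (\<alpha> # \<alpha>s)" for i
      using that based Ps0 Ps(2) by (cases i) auto
    fix \<chi> :: "('a \<Rightarrow> nat) \<Rightarrow> nat" assume \<chi>: "\<forall>g. \<chi> g < r"
    obtain f' where f': "embedding LP Q (Ps (length \<alpha>s)) f'"
      and mono': "\<And>\<beta> g g'. \<beta> \<in> set \<alpha>s \<Longrightarrow> g \<in> copies_over A Q \<pi>' \<beta> \<Longrightarrow> g' \<in> copies_over A Q \<pi>' \<beta> \<Longrightarrow>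
          \<chi> (compose (verts A) f' g) = \<chi> (compose (verts A) f' g')"
      using IH[OF \<chi>] by blast
    obtain f where f: "embedding LP P Q f" and mono: "\<And>g g'. g \<in> copies_over A P \<pi> \<alpha> \<Longrightarrow>
      g' \<in> copies_over A P \<pi> \<alpha> \<Longrightarrow> \<chi> (compose (verts A) f' (compose (verts A) f g)) =
        \<chi> (compose (verts A) f' (compose (verts A) f g'))"
      using spec[OF step, of "\<lambda>g. \<chi> (compose (verts A) f' g)"] \<chi> by blast
    have assoc: "compose (verts A) (\<lambda>v. f' (f v)) g = compose (verts A) f' (compose (verts A) f g)" for g
      by (auto simp: compose_def)
    \<comment> \<open>For projections in the tail, homogeneity already holds in \<open>Q\<close> and
      passes to the copies coming from \<open>P\<close>; for the head it is due to the choice of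
      \<open>f\<close>.\<close>
    have "\<chi> (compose (verts A) (\<lambda>v. f' (f v)) g) = \<chi> (compose (verts A) (\<lambda>v. f' (f v)) g')"
      if "\<beta> \<in> set (\<alpha> # \<alpha>s)" and g: "g \<in> copies_over A P \<pi> \<beta>" "g' \<in> copies_over A P \<pi> \<beta>" for \<beta> g g'
    proof (cases "\<beta> \<in> set \<alpha>s")
      case True
      show ?thesis unfolding assoc
        by (rule mono'[OF True compose_copies_over[OF P Q A f g(1)] compose_copies_over[OF P Q A f g(2)]])
    next
      case False
      then have "\<beta> = \<alpha>" using that(1) by simp
      then show ?thesis unfolding assoc using g by (intro mono) simp_all
    qed
    moreover have "embedding LP P (?Ps (length (\<alpha> # \<alpha>s))) (\<lambda>v. f' (f v))"
      using embedding_comp[OF partite_overD(2)[OF P] partite_overD(2)[OF Q] f f'] by simp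
    ultimately show "\<exists>f. embedding LP P (?Ps (length (\<alpha> # \<alpha>s))) f \<and>
        (\<forall>\<beta>\<in>set (\<alpha> # \<alpha>s). \<forall>g\<in>copies_over A P \<pi> \<beta>. \<forall>g'\<in>copies_over A P \<pi> \<beta>.
          \<chi> (compose (verts A) f g) = \<chi> (compose (verts A) f g'))"
      by (intro exI[of _ "\<lambda>v. f' (f v)"] conjI ballI)
  qed
qed

end

text \<open>A constant colouring already produces a copy of \<open>B\<close>, so the initial
  disjoint union has at least one component.\<close>

lemma arrows_Emb_nonempty:
  assumes "arrows L D B A k" "0 < k"
  shows "Emb L B D \<noteq> {}"
proof -
  have "(\<lambda>_. 0) \<in> Emb L A D \<rightarrow> {..<k}" using assms(2) by simp
  then show ?thesis using assms(1) unfolding arrows_def by blast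
qed

lemma Emb_compose:
  assumes "L_structure L A" "L_structure L B" "e \<in> Emb L A B" "f \<in> Emb L B C"
  shows "compose (verts A) f e \<in> Emb L A C"
  using embedding_compose[OF assms(1,2), of e C f] assms(3,4) by (simp add: Emb_def compose_def)

lemma isomorphic_image:
  assumes "L_structure L A" "embedding L A B f"
  shows "isomorphic L (induced B (f ` verts A)) A"
  unfolding isomorphic_def
proof (intro exI conjI)
  show "embedding L (induced B (f ` verts A)) A (inv_into (verts A) f)"
    by (rule embedding_inv[OF assms])
  show "inv_into (verts A) f ` verts (induced B (f ` verts A)) = verts A"
    using inv_into_image_cancel[OF embeddingD(1)[OF assms] subset_refl] by simp
qed

theorem theoremA7:
  fixes L :: "('r, 'f) lang"
    and A :: "('a, 'r, 'f) struct"
    and B :: "('b, 'r, 'f) struct"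
    and D :: "('d, 'r, 'f) struct"
  assumes "language L"
    and "L_structure L A" and "L_structure L B" and "L_structure L D"
    and "finite (verts D)"
    and "arrows L D B A 2"
  shows "\<exists>P :: (nat, 'r + 'd, 'f) struct.
    D_partite L D P \<and> arrows L (reduct P) B A 2 \<and>
    (\<exists>(m::nat) (Ps :: nat \<Rightarrow> (nat, 'r + 'd, 'f) struct).
       Ps m = P \<and>
       (\<forall>i\<le>m. D_partite L D (Ps i)) \<and>
       disjoint_union_of_copies L B (reduct (Ps 0)) \<and>
       (\<forall>i<m. \<exists>\<alpha>. embedding L A D \<alpha> \<and> based L D (Ps i) (\<alpha> ` verts A) (Ps (Suc i))) \<and>
       (\<forall>i\<le>m. \<forall>E. irreducible_sub (pred_lang L (verts D)) E (Ps i) \<longrightarrow>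
          (\<exists>B'. substructure L B' D \<and> isomorphic L (induced D B') B \<and>
             substructure L (projection (verts D) (Ps i) ` E) (induced D B'))))"
proof -
  note A = assms(2) and B = assms(3) and D = assms(4)
  define \<B> where "\<B> = (\<lambda>b. b ` verts B) ` Emb L B D"
  interpret ambient_structure L D \<B> using assms(4,5) by unfold_locales
  obtain P0 :: "(nat, 'r + 'd, 'f) struct" and \<pi> where P0: "partite_over P0 \<pi>"
    and disj: "disjoint_union_of_copies L B (reduct P0)"
    and copy: "\<And>b. b \<in> Emb L B D \<Longrightarrow> \<exists>f. embedding L B (reduct P0) f \<and> (\<forall>v\<in>verts B. \<pi> (f v) = b v)"
    using initial_system[OF assms(1,3) arrows_Emb_nonempty[OF assms(6)]] unfolding \<B>_def by auto
  \<comment> \<open>Without any embedding of A into \<open>D\<close> the list of steps is empty and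
    the initial system is the last one; otherwise A is finite along with \<open>D\<close>.\<close>
  have "finite (Emb L A D)"
  proof (cases "Emb L A D = {}")
    case False
    then obtain \<alpha> where "embedding L A D \<alpha>" by (auto simp: Emb_def)
    from embeddingD(1,2)[OF A this] finite_D have "finite (verts A)" by (auto intro: inj_on_finite)
    then show ?thesis by (rule finite_Emb[OF _ finite_D])
  qed simp
  then obtain \<alpha>s where \<alpha>s: "set \<alpha>s = Emb L A D" using finite_list by blast
  have emb: "\<And>\<alpha>. \<alpha> \<in> set \<alpha>s \<Longrightarrow> embedding L A D \<alpha>" using \<alpha>s by (simp add: Emb_def)
  obtain Ps :: "nat \<Rightarrow> (nat, 'r + 'd, 'f) struct" where Ps0: "Ps 0 = P0"
    and over: "\<And>i. i \<le> length \<alpha>s \<Longrightarrow> \<exists>\<pi>. partite_over (Ps i) \<pi>"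
    and based: "\<And>i. i < length \<alpha>s \<Longrightarrow> based L D (Ps i) (\<alpha>s ! i ` verts A) (Ps (Suc i))"
    and ramsey: "\<And>\<chi>. (\<forall>g. \<chi> g < (2::nat)) \<Longrightarrow> \<exists>f. embedding LP P0 (Ps (length \<alpha>s)) f \<and>
        (\<forall>\<alpha>\<in>set \<alpha>s. \<forall>g\<in>copies_over A P0 \<pi> \<alpha>. \<forall>g'\<in>copies_over A P0 \<pi> \<alpha>.
          \<chi> (compose (verts A) f g) = \<chi> (compose (verts A) f g'))"
    using partite_construction[OF A zero_less_numeral P0 emb, where \<alpha>s = \<alpha>s] by blast
  let ?P = "Ps (length \<alpha>s)"
  note p0 = partite_overD[OF P0]
  have "arrows L (reduct ?P) B A 2"
    unfolding arrows_def
  proof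
    fix \<chi> assume \<chi>: "\<chi> \<in> Emb L A (reduct ?P) \<rightarrow> {..<2::nat}"
    \<comment> \<open>\<open>arrows\<close> bounds \<open>\<chi>\<close> on embeddings only;
      truncation at 1 gives a total colouring with two colours that agrees with
      \<open>\<chi>\<close> there.\<close>
    define \<chi>' where "\<chi>' g = min (\<chi> g) 1" for g
    have \<chi>'_eq: "\<chi>' g = \<chi> g" if "g \<in> Emb L A (reduct ?P)" for g
      using \<chi> that by (auto simp: \<chi>'_def Pi_iff)
    have "\<forall>g. \<chi>' g < 2" by (simp add: \<chi>'_def min_less_iff_disj)
    then obtain f where f: "embedding LP P0 ?P f"
      and mono: "\<And>\<alpha> g g'. \<alpha> \<in> set \<alpha>s \<Longrightarrow> g \<in> copies_over A P0 \<pi> \<alpha> \<Longrightarrow> g' \<in> copies_over A P0 \<pi> \<alpha> \<Longrightarrow>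
          \<chi>' (compose (verts A) f g) = \<chi>' (compose (verts A) f g')"
      using ramsey by blast
    \<comment> \<open>The colouring of the copies of A in \<open>D\<close> to which the arrow
      applies. For an \<alpha> without copies in \<open>P0\<close> the choice is arbitrary, but the
      value still lies below 2.\<close>
    define \<psi> where "\<psi> \<alpha> = \<chi>' (compose (verts A) f (SOME g. g \<in> copies_over A P0 \<pi> \<alpha>))" for \<alpha>
    have \<psi>_eq: "\<chi>' (compose (verts A) f g) = \<psi> \<alpha>"
      if "\<alpha> \<in> set \<alpha>s" "g \<in> copies_over A P0 \<pi> \<alpha>" for \<alpha> g
      unfolding \<psi>_def using mono[OF that] someI[of "\<lambda>g. g \<in> copies_over A P0 \<pi> \<alpha>"] that(2) by blast
    have "\<psi> \<in> Emb L A D \<rightarrow> {..<2}" by (simp add: \<psi>_def \<chi>'_def min_less_iff_disj)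
    then obtain b c where b: "b \<in> Emb L B D"
      and c: "\<And>e. e \<in> Emb L A B \<Longrightarrow> \<psi> (compose (verts A) b e) = c"
      using assms(6) unfolding arrows_def by blast
    obtain h where h: "embedding L B (reduct P0) h" "\<And>v. v \<in> verts B \<Longrightarrow> \<pi> (h v) = b v"
      using copy[OF b] by blast
    have "embedding L B (reduct ?P) (compose (verts B) f h)"
      by (rule embedding_compose[OF B p0(3) h(1) embedding_reduct[OF p0(2) f]])
    then have fh: "compose (verts B) f h \<in> Emb L B (reduct ?P)" by (simp add: Emb_def compose_def)
    \<comment> \<open>The copy \<open>h\<close> of \<open>B\<close> lies over \<open>b\<close>, so a
      copy \<open>e\<close> of A in \<open>B\<close> turns into one in \<open>P0\<close> over the
      composite of \<open>b\<close> and \<open>e\<close>; its colour is the one that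
      \<open>\<psi>\<close> gives to this composite.\<close>
    have "\<chi> (compose (verts A) (compose (verts B) f h) e) = c" if e: "e \<in> Emb L A B" for e
    proof -
      have eB: "embedding L A B e" using e by (simp add: Emb_def)
      have ev: "e a \<in> verts B" if "a \<in> verts A" for a using embeddingD(2)[OF A eB] that by auto
      have "compose (verts A) h e \<in> copies_over A P0 \<pi> (compose (verts A) b e)"
        using embedding_compose[OF A B eB h(1)] h(2) ev
        by (auto simp: copies_over_def Emb_def compose_def)
      moreover have "compose (verts A) b e \<in> set \<alpha>s" unfolding \<alpha>s by (rule Emb_compose[OF A B e b])
      moreover have "compose (verts A) (compose (verts B) f h) e = compose (verts A) f (compose (verts A) h e)"
        using ev by (auto simp: compose_def)
      ultimately show ?thesis
        using \<psi>_eq c[OF e] \<chi>'_eq[OF Emb_compose[OF A B e fh]] by metis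
    qed
    then show "\<exists>f\<in>Emb L B (reduct ?P). \<exists>c. \<forall>e\<in>Emb L A B. \<chi> (compose (verts A) f e) = c"
      using fh by blast
  qed
  moreover have "\<exists>B'. substructure L B' D \<and> isomorphic L (induced D B') B \<and>
      substructure L (projection (verts D) (Ps i) ` E) (induced D B')"
    if i: "i \<le> length \<alpha>s" and E: "irreducible_sub LP E (Ps i)" for i E
  proof -
    obtain \<pi>' where "partite_over (Ps i) \<pi>'" using over[OF i] by blast
    then have pr: "partite_over (Ps i) (projection (verts D) (Ps i))"
      by (rule partite_over_cong) (simp add: projection_eq[OF \<open>partite_over (Ps i) \<pi>'\<close>])
    note q = partite_overD[OF pr]
    have EL: "irreducible_sub L E (reduct (Ps i))" using E by (simp add: irreducible_sub_reduct[OF q(2)])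
    then have sub: "substructure L E (reduct (Ps i))" by (simp add: irreducible_sub_def)
    obtain b where b: "b \<in> Emb L B D" "projection (verts D) (Ps i) ` E \<subseteq> b ` verts B"
      using q(10)[OF EL] by (auto simp: \<B>_def)
    have bD: "embedding L B D b" using b(1) by (simp add: Emb_def)
    have subB: "substructure L (b ` verts B) D" by (rule embedding_substructure[OF B bD])
    \<comment> \<open>The projection is an embedding on \<open>E\<close>, so the image is closed in
      \<open>D\<close> and hence also in the copy of \<open>B\<close> that contains it.\<close>
    moreover have "substructure L (projection (verts D) (Ps i) ` E) D"
      using embedding_substructure[OF L_structure_induced[OF q(3) sub] q(9)[OF EL]] by simp
    ultimately show ?thesis
      using b(2) isomorphic_image[OF B bD] by (auto simp: substructure_induced[OF subB])
  qed
  moreover have "\<forall>i\<le>length \<alpha>s. D_partite L D (Ps i)" using over D_partite by blast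
  moreover have "\<forall>i<length \<alpha>s. \<exists>\<alpha>. embedding L A D \<alpha> \<and> based L D (Ps i) (\<alpha> ` verts A) (Ps (Suc i))"
    using based emb nth_mem by blast
  ultimately show ?thesis using disj Ps0
    by (intro exI[of _ ?P] conjI exI[of _ "length \<alpha>s"] exI[of _ Ps]) auto
qed

end
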